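(* Let $G$ be an infinite polycyclic group with a nontrivial strictly exponentially distorted element $x\in\mathrm{Fitt}(G)$. Then $n\preceq\mathrm{RF}_G(n)$. If $x\in\gamma_m(\mathrm{Fitt}(G))$ where $m>1$, then $n^{m+1}\preceq\mathrm{RF}_G(n)$.
   Context: A polycyclic group is a solvable group all of whose subgroups are finitely generated. $\mathrm{Fitt}(G)$, the Fitting subgroup, is the subgroup generated by all normal nilpotent subgroups of $G$. $\gamma_m$ denotes the $m$-th term of the lower central series, with $\gamma_1(N)=N$. $\mathbb{N}$ denotes the positive integers. For a finitely generated group $G$ with finite generating subset $S$, $\|x\|_S$ is the word length of $x$. An infinite order element $x\in G$ is strictly exponentially distorted if there are constants $C_1,C_2>0$ with $C_1|n|\le 2^{\|x^n\|_S}\le C_2|n|$ for all integers $n>0$. For a finitely generated, residually finite group $G$ and $x\in G\setminus\{1\}$ let $\mathrm{D}_G(x)=\min\{|H| : \varphi:G\to H \text{ a surjective homomorphism},\ |H|<\infty,\ \varphi(x)\ne 1\}$, and $\mathrm{RF}_{G}(n)=\mathrm{RF}_{G,S}(n)=\max\{\mathrm{D}_G(x) : \|x\|_S\le n,\ x\ne 1\}$. For nondecreasing functions $f,g$ on $\mathbb{N}$, $f\preceq g$ means that there is a constant $C>0$ (which may be taken to be an integer) with $f(n)\le C\,g(Cn)$ for all $n$; the choice of $S$ does not affect $\mathrm{RF}_G$ up to this relation in both directions. *)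

theory Defs
  imports "HOL-Algebra.Algebra" "HOL-Library.Extended_Nat"
begin

section \<open>Polycyclic groups\<close>

definition fg_subgroup :: "('a, 'b) monoid_scheme \<Rightarrow> 'a set \<Rightarrow> bool" where
  "fg_subgroup G H \<longleftrightarrow> (\<exists>S. finite S \<and> S \<subseteq> carrier G \<and> generate G S = H)"

definition polycyclic :: "('a, 'b) monoid_scheme \<Rightarrow> bool" where
  "polycyclic G \<longleftrightarrow> group G \<and> solvable G \<and> (\<forall>H. subgroup H G \<longrightarrow> fg_subgroup G H)"

section \<open>Lower central series and Fitting subgroup\<close>

definition commutator_subgroup :: "('a, 'b) monoid_scheme \<Rightarrow> 'a set \<Rightarrow> 'a set \<Rightarrow> 'a set" where
  "commutator_subgroup G A B =
     generate G {a \<otimes>\<^bsub>G\<^esub> b \<otimes>\<^bsub>G\<^esub> inv\<^bsub>G\<^esub> a \<otimes>\<^bsub>G\<^esub> inv\<^bsub>G\<^esub> b | a b. a \<in> A \<and> b \<in> B}"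

text \<open>The series is indexed from 1, as \<open>\<gamma>\<^sub>1(G) = G\<close> and \<open>\<gamma>\<^sub>m\<^sub>+\<^sub>1(G) = [\<gamma>\<^sub>m(G), G]\<close>;
  the index 0 carries no meaning (it also yields \<open>G\<close>).\<close>

definition lower_central :: "('a, 'b) monoid_scheme \<Rightarrow> nat \<Rightarrow> 'a set" where
  "lower_central G m = ((\<lambda>H. commutator_subgroup G H (carrier G)) ^^ (m - 1)) (carrier G)"

definition nilpotent_group :: "('a, 'b) monoid_scheme \<Rightarrow> bool" where
  "nilpotent_group G \<longleftrightarrow> group G \<and> (\<exists>m\<ge>1. lower_central G m = {\<one>\<^bsub>G\<^esub>})"

definition Fitt :: "('a, 'b) monoid_scheme \<Rightarrow> 'a set" where
  "Fitt G = generate G (\<Union>{N. N \<lhd> G \<and> nilpotent_group (G\<lparr>carrier := N\<rparr>)})"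

section \<open>Word length and distortion\<close>

definition finite_generating_set :: "('a, 'b) monoid_scheme \<Rightarrow> 'a set \<Rightarrow> bool" where
  "finite_generating_set G S \<longleftrightarrow> finite S \<and> S \<subseteq> carrier G \<and> generate G S = carrier G"

definition word_length :: "('a, 'b) monoid_scheme \<Rightarrow> 'a set \<Rightarrow> 'a \<Rightarrow> nat" where
  "word_length G S x =
     (LEAST n. \<exists>w. length w = n \<and> set w \<subseteq> S \<union> m_inv G ` S \<and> foldr (\<otimes>\<^bsub>G\<^esub>) w \<one>\<^bsub>G\<^esub> = x)"

text \<open>\<open>group.ord G x = 0\<close> says that \<open>x\<close> has infinite order.\<close>

definition strictly_exp_distorted :: "('a, 'b) monoid_scheme \<Rightarrow> 'a set \<Rightarrow> 'a \<Rightarrow> bool" where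
  "strictly_exp_distorted G S x \<longleftrightarrow>
     x \<in> carrier G \<and> group.ord G x = 0 \<and>
     (\<exists>C1 C2 :: real. C1 > 0 \<and> C2 > 0 \<and>
        (\<forall>n::nat. n > 0 \<longrightarrow>
           C1 * real n \<le> 2 ^ word_length G S (x [^]\<^bsub>G\<^esub> n) \<and>
           2 ^ word_length G S (x [^]\<^bsub>G\<^esub> n) \<le> C2 * real n))"

section \<open>Residual finiteness growth\<close>

text \<open>The finite groups \<open>H\<close> are taken with carrier a set of natural numbers; up to isomorphism
  this covers all finite groups, see \<open>detect_le_order\<close> below.  Values lie in \<^typ>\<open>enat\<close> so that the
  minimum over the empty set is \<open>\<infinity>\<close>; for residually finite \<open>G\<close> and \<open>x \<noteq> 1\<close>
  the infimum is an attained, finite minimum.\<close>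

definition detect :: "('a, 'b) monoid_scheme \<Rightarrow> 'a \<Rightarrow> enat" where
  "detect G x = Inf {enat (order H) | (H :: nat monoid) \<phi>.
     group H \<and> finite (carrier H) \<and> \<phi> \<in> epi G H \<and> \<phi> x \<noteq> \<one>\<^bsub>H\<^esub>}"

lemma detect_le_order:
  fixes H :: "('c, 'd) monoid_scheme"
  assumes "group G" "x \<in> carrier G"
    and H: "group H" "finite (carrier H)" and phi: "\<phi> \<in> epi G H" "\<phi> x \<noteq> \<one>\<^bsub>H\<^esub>"
  shows "detect G x \<le> enat (order H)"
proof -
  obtain f :: "'c \<Rightarrow> nat" where f: "inj_on f (carrier H)"
    using H(2) finite_imp_inj_to_nat_seg by blast
  define K where "K = image_group f H"
  interpret H: group H by (rule H(1))
  have iso: "f \<in> iso H K"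
    using f by (auto simp: iso_def hom_def bij_betw_def K_def image_group_def)
  have "K\<lparr>one := f \<one>\<^bsub>H\<^esub>\<rparr> = K"
    by (simp add: K_def image_group_def)
  then have K: "group K"
    using H.iso_imp_img_group[OF iso] by simp
  have "f \<circ> \<phi> \<in> epi G K"
    using phi(1) iso epi_compose iso_iff_mon_epi by blast
  moreover have "(f \<circ> \<phi>) x \<noteq> \<one>\<^bsub>K\<^esub>"
  proof -
    have "\<phi> x \<in> carrier H"
      using phi(1) assms(2) by (auto simp: epi_def hom_def)
    thus ?thesis
      using phi(2) f by (auto simp: K_def image_group_def inj_on_def)
  qed
  moreover have "carrier K = f ` carrier H"
    by (simp add: K_def image_group_def)
  ultimately have "enat (order K) \<in> {enat (order H) | (H :: nat monoid) \<phi>.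
     group H \<and> finite (carrier H) \<and> \<phi> \<in> epi G H \<and> \<phi> x \<noteq> \<one>\<^bsub>H\<^esub>}"
    using K H(2) by (intro CollectI exI[of _ K] exI[of _ "f \<circ> \<phi>"]) simp
  moreover have "order K = order H"
    using iso by (auto simp: iso_def order_def dest: bij_betw_same_card)
  ultimately show ?thesis
    unfolding detect_def by (metis (no_types, lifting) Inf_lower)
qed

text \<open>The supremum is over a finite set, hence a maximum, whenever \<open>S\<close> is finite.\<close>

definition RF :: "('a, 'b) monoid_scheme \<Rightarrow> 'a set \<Rightarrow> nat \<Rightarrow> enat" where
  "RF G S n = Sup {detect G x | x. x \<in> carrier G \<and> x \<noteq> \<one>\<^bsub>G\<^esub> \<and> word_length G S x \<le> n}"

definition growth_le :: "(nat \<Rightarrow> enat) \<Rightarrow> (nat \<Rightarrow> enat) \<Rightarrow> bool" (infix \<open>\<preceq>\<close> 50) where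
  "f \<preceq> g \<longleftrightarrow> (\<exists>C::nat. C > 0 \<and> (\<forall>n\<ge>1. f n \<le> enat C * g (C * n)))"

end

theory Submission
  imports Defs
begin

text \<open>If \<open>\<phi>(x ^ M) \<noteq> 1\<close> in a finite quotient \<open>H\<close>, then some prime power \<open>p ^ j\<close> divides the order of \<open>\<phi>(x)\<close> but
  not \<open>M\<close>. There is \<open>M\<close> with \<open>log M = O(n)\<close> that is divisible by all \<open>p ^ j < n ^ d\<close> with \<open>p < n\<close>; by the distortion of \<open>x\<close>, the
  word length of \<open>x ^ M\<close> is then \<open>O(n)\<close>, while \<open>|H| \<ge> n ^ d\<close> or \<open>p \<ge> n\<close>. In the latter case, put \<open>d = m + 1\<close>. The image
  of \<open>x\<close> lies in \<open>\<gamma>\<^sub>m(F)\<close> for a nilpotent subgroup \<open>F\<close> of \<open>H\<close>, namely the largest normal one, and \<open>p\<close> divides its order.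
  By bilinearity of commutators \<open>p\<close> divides the index of \<open>\<gamma>\<^sub>i\<^sub>+\<^sub>1(F)\<close> in \<open>\<gamma>\<^sub>i(F)\<close> for all \<open>i \<le> m\<close>, and even \<open>p\<^sup>2\<close> divides
  it for \<open>i = 1\<close>, as a nilpotent group that is cyclic modulo its commutator subgroup is abelian. Hence
  \<open>|H| \<ge> p ^ (m + 1)\<close>.\<close>

section \<open>Exponents of exponential size\<close>

text \<open>A substitute for the product of all primes up to \<open>2 ^ r\<close>: each such prime
  divides one of the central binomial coefficients, and the size of the whole product is easy to
  control.\<close>

definition binomial_tower :: "nat \<Rightarrow> nat" where
  "binomial_tower r = (\<Prod>i<r. 2 ^ Suc i choose 2 ^ i)"

text \<open>The prime \<open>p\<close> occurs in \<open>fact (2 * m)\<close> but not in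
  \<open>fact m\<close>, so it survives in the quotient.\<close>

lemma prime_dvd_central_binomial:
  fixes p m :: nat
  assumes "Factorial_Ring.prime p" "m < p" "p \<le> 2 * m"
  shows "p dvd (2 * m choose m)"
proof -
  have "fact m * fact (2 * m - m) * (2 * m choose m) = (fact (2 * m) :: nat)"
    by (rule binomial_fact_lemma) simp
  moreover have "p dvd fact (2 * m)"
    using assms by (simp add: prime_dvd_fact_iff)
  ultimately have "p dvd fact m * fact m * (2 * m choose m)"
    by simp
  moreover have "\<not> p dvd fact m"
    using assms by (simp add: prime_dvd_fact_iff)
  ultimately show ?thesis
    using assms(1) by (simp add: prime_dvd_mult_iff)
qed

text \<open>Primes between \<open>2 ^ r\<close> and \<open>2 ^ Suc r\<close> divide the new factor;
  smaller ones are covered by induction.\<close>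

lemma prime_dvd_binomial_tower:
  fixes p :: nat
  assumes "Factorial_Ring.prime p" "p \<le> 2 ^ r"
  shows "p dvd binomial_tower r"
  using assms(2)
proof (induction r)
  case 0
  then show ?case
    using assms(1) prime_ge_2_nat[of p] by simp
next
  case (Suc r)
  then show ?case
    using prime_dvd_central_binomial[OF assms(1), of "2 ^ r"]
    by (cases "p \<le> 2 ^ r") (auto simp: binomial_tower_def)
qed

lemma binomial_tower_pos: "binomial_tower r > 0"
  unfolding binomial_tower_def by (intro prod_pos) (simp add: zero_less_binomial_iff)

text \<open>A binomial coefficient with upper entry \<open>n\<close> is at most
  \<open>2 ^ n\<close>; the exponents form a geometric series.\<close>

lemma binomial_tower_le: "binomial_tower r \<le> 2 ^ (2 * 2 ^ r)"
proof (induction r)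
  case 0
  then show ?case by (simp add: binomial_tower_def)
next
  case (Suc r)
  have "binomial_tower (Suc r) = binomial_tower r * (2 ^ Suc r choose 2 ^ r)"
    by (simp add: binomial_tower_def)
  also have "\<dots> \<le> 2 ^ (2 * 2 ^ r) * 2 ^ (2 ^ Suc r)"
    by (intro mult_mono Suc binomial_le_pow2) auto
  also have "\<dots> = 2 ^ (2 * 2 ^ Suc r)"
    by (simp flip: power_add)
  finally show ?case .
qed

text \<open>Absorbs a logarithmic factor: the power of the factorial used below has an exponent of
  order \<open>r ^ 2 * 2 ^ r\<close>, which has to stay within \<open>O(4 ^ r)\<close>.\<close>

lemma square_le_twice_power_two: "r ^ 2 \<le> 2 * 2 ^ (r :: nat)"
proof (cases "r < 4")
  case True
  then have "r \<in> {0, 1, 2, 3}" by auto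
  then show ?thesis by auto
next
  case False
  then have "4 \<le> r" by simp
  then show ?thesis
  proof (induction r rule: nat_induct_at_least)
    case (Suc r)
    have "4 * r \<le> r * r" using Suc.hyps by (intro mult_right_mono) auto
    then have "1 + 2 * r \<le> r * r" using Suc.hyps by linarith
    then have "(Suc r) ^ 2 \<le> 2 * r ^ 2"
      using Suc.hyps by (simp add: power2_eq_square del: One_nat_def)
    then show ?case using Suc by simp
  qed simp
qed

lemma prime_power_not_dvd_power:
  fixes p a :: nat
  assumes "p dvd a" "\<not> p ^ j dvd a ^ e"
  shows "e < j"
proof (rule ccontr)
  assume "\<not> e < j"
  then have "p ^ j dvd p ^ e" by (simp add: le_imp_power_dvd)
  also have "\<dots> dvd a ^ e" by (rule dvd_power_same[OF assms(1)])
  finally show False using assms(2) by contradiction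
qed

text \<open>With \<open>n \<le> 4 ^ r < 4 n\<close>, the primes up to \<open>\<surd>n\<close> are handled by a power of \<open>(2 ^ r)!\<close>, whose
  exponent may grow like \<open>log n\<close>; for the other primes below \<open>n\<close> a bounded exponent suffices.\<close>

lemma exists_exp_bounded_multiple:
  fixes d :: nat
  shows "\<exists>C>0. \<forall>n\<ge>1. \<exists>M>0. M \<le> 2 ^ (C * n) \<and>
    (\<forall>p j. Factorial_Ring.prime p \<longrightarrow> \<not> p ^ j dvd M \<longrightarrow> n ^ d \<le> p ^ j \<or> n \<le> p)"
\<comment> \<open>Each of the two factors of \<open>M\<close> is at most
  \<open>2 ^ (4 * d * 4 ^ r)\<close>, and \<open>4 ^ r \<le> 4 * n\<close> turns the total exponent
  into \<open>32 * d * n\<close>. The summand 1 keeps the constant positive when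
  \<open>d = 0\<close>.\<close>
proof (rule exI[of _ "32 * d + 1"], intro conjI allI impI)
  fix n :: nat
  assume n: "n \<ge> 1"
  obtain r where r: "n \<le> 4 ^ r" "4 ^ r \<le> 4 * n"
  proof -
    define r where "r = (LEAST r. n \<le> 4 ^ r)"
    have "n < 4 ^ n" by (rule power_gt_expt) simp
    then have r1: "n \<le> 4 ^ r"
      unfolding r_def by (intro LeastI[of "\<lambda>r. n \<le> 4 ^ r" n]) simp
    have "4 ^ r \<le> 4 * n"
    proof (cases r)
      case 0
      then show ?thesis using n by simp
    next
      case (Suc s)
      then have "\<not> n \<le> 4 ^ s"
        using not_less_Least[of s "\<lambda>r. n \<le> 4 ^ r"] by (simp add: r_def)
      then show ?thesis by (simp add: Suc)
    qed
    with r1 show thesis by (rule that)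
  qed
  \<comment> \<open>The index \<open>2 * r\<close> covers all primes up to \<open>4 ^ r\<close>,
    hence up to \<open>n\<close>. For \<open>p > 2 ^ r\<close> the exponent \<open>2 * d\<close>
    suffices, since \<open>(2 ^ r) ^ (2 * d) = 4 ^ (r * d)\<close>; for \<open>p \<le> 2 ^ r\<close>
    only \<open>p \<ge> 2\<close> is available, and the exponent \<open>2 * r * d\<close> gives the
    same value.\<close>
  define M :: nat where "M = binomial_tower (2 * r) ^ (2 * d) * fact (2 ^ r) ^ (2 * r * d)"
  have four: "(4 :: nat) ^ r = 2 ^ (2 * r)" by (simp add: power_mult)
  have "M > 0" using binomial_tower_pos by (simp add: M_def)
  moreover have "M \<le> 2 ^ ((32 * d + 1) * n)"
  proof -
    have "binomial_tower (2 * r) ^ (2 * d) \<le> (2 ^ (2 * 2 ^ (2 * r))) ^ (2 * d)"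
      by (intro power_mono binomial_tower_le) simp
    also have "\<dots> = 2 ^ (4 * d * 4 ^ r)"
      by (simp add: four algebra_simps flip: power_mult)
    finally have 1: "binomial_tower (2 * r) ^ (2 * d) \<le> 2 ^ (4 * d * 4 ^ r)" .
    have "fact (2 ^ r) \<le> ((2 ^ r) ^ (2 ^ r) :: nat)"
      using fact_le_power[of "2 ^ r", where ?'a = nat] by simp
    then have "fact (2 ^ r) ^ (2 * r * d) \<le> ((2 ^ r) ^ (2 ^ r) :: nat) ^ (2 * r * d)"
      by (intro power_mono) auto
    also have "\<dots> = 2 ^ (2 * d * (r ^ 2 * 2 ^ r))"
      by (simp add: power2_eq_square algebra_simps flip: power_mult)
    also have "\<dots> \<le> 2 ^ (4 * d * (2 ^ r * 2 ^ r))"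
    proof (intro power_increasing)
      have "2 * d * (r ^ 2 * 2 ^ r) = 2 * d * 2 ^ r * r ^ 2" by (simp only: mult_ac)
      also have "\<dots> \<le> 2 * d * 2 ^ r * (2 * 2 ^ r)"
        by (intro mult_left_mono square_le_twice_power_two) simp
      finally show "2 * d * (r ^ 2 * 2 ^ r) \<le> 4 * d * (2 ^ r * 2 ^ r)" by simp
    qed simp
    also have "\<dots> = 2 ^ (4 * d * 4 ^ r)"
      by (simp add: four power_add mult_2)
    finally have "M \<le> 2 ^ (4 * d * 4 ^ r) * 2 ^ (4 * d * 4 ^ r)"
      unfolding M_def using 1 by (intro mult_mono) auto
    also have "\<dots> = 2 ^ (8 * d * 4 ^ r)" by (simp flip: power_add)
    also have "\<dots> \<le> 2 ^ (8 * d * (4 * n))"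
      by (intro power_increasing mult_left_mono r) auto
    also have "\<dots> \<le> 2 ^ ((32 * d + 1) * n)"
      by (intro power_increasing) auto
    finally show ?thesis .
  qed
  moreover have "n ^ d \<le> p ^ j \<or> n \<le> p" if p: "Factorial_Ring.prime p" "\<not> p ^ j dvd M" for p j
  proof (cases "n \<le> p")
    case False
    have p2: "2 \<le> p" using p(1) by (rule prime_ge_2_nat)
    have nd: "n ^ d \<le> (4 ^ r) ^ d" by (intro power_mono r) simp
    show ?thesis
    proof (cases "p \<le> 2 ^ r")
      case True
      then have "p dvd fact (2 ^ r)" using p(1) by (simp add: prime_dvd_fact_iff)
      moreover have "\<not> p ^ j dvd fact (2 ^ r) ^ (2 * r * d)"
        using p(2) by (auto simp: M_def)
      ultimately have "2 * r * d < j" by (rule prime_power_not_dvd_power)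
      then have "p ^ (2 * r * d) \<le> p ^ j"
        using p2 by (intro power_increasing) auto
      moreover have "2 ^ (2 * r * d) \<le> p ^ (2 * r * d)"
        using p2 by (intro power_mono) auto
      moreover have "(4 ^ r) ^ d = (2 :: nat) ^ (2 * r * d)"
        by (simp only: four power_mult)
      ultimately show ?thesis
        using nd by linarith
    next
      case large: False
      have "p dvd binomial_tower (2 * r)"
        using False r(1) p(1) by (intro prime_dvd_binomial_tower) (auto simp flip: four)
      moreover have "\<not> p ^ j dvd binomial_tower (2 * r) ^ (2 * d)"
        using p(2) by (auto simp: M_def)
      ultimately have "2 * d < j" by (rule prime_power_not_dvd_power)
      then have "p ^ (2 * d) \<le> p ^ j"
        using p2 by (intro power_increasing) auto
      moreover have "(2 ^ r) ^ (2 * d) \<le> p ^ (2 * d)"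
        using large by (intro power_mono) auto
      moreover have "(2 ^ r) ^ (2 * d) = ((4 :: nat) ^ r) ^ d"
        by (simp only: four power_mult[symmetric] mult_ac)
      ultimately show ?thesis
        using nd by linarith
    qed
  qed simp
  ultimately show "\<exists>M>0. M \<le> 2 ^ ((32 * d + 1) * n) \<and>
    (\<forall>p j. Factorial_Ring.prime p \<longrightarrow> \<not> p ^ j dvd M \<longrightarrow> n ^ d \<le> p ^ j \<or> n \<le> p)"
    by blast
qed simp

text \<open>Some prime has a larger multiplicity in \<open>a\<close> than in \<open>b\<close>; its
  full power in \<open>a\<close> is the witness.\<close>

lemma prime_power_dvd_not_dvd:
  fixes a b :: nat
  assumes "a > 0" "b > 0" "\<not> a dvd b"
  obtains p j where "Factorial_Ring.prime p" "j > 0" "p ^ j dvd a" "\<not> p ^ j dvd b"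
proof -
  obtain p where p: "Factorial_Ring.prime p" "multiplicity p a > multiplicity p b"
    using assms multiplicity_le_imp_dvd[of a b] by (metis not_less neq0_conv)
  show thesis
  proof (rule that[OF p(1)])
    show "0 < multiplicity p a" using p by simp
    show "p ^ multiplicity p a dvd a" by (rule multiplicity_dvd)
    show "\<not> p ^ multiplicity p a dvd b"
      using p(2) power_dvd_iff_le_multiplicity[of b p "multiplicity p a"] assms(2) not_prime_unit[of p] p(1)
      by (metis not_less neq0_conv)
  qed
qed

section \<open>Commutators\<close>

abbreviation (in monoid) commutator :: "'a \<Rightarrow> 'a \<Rightarrow> 'a" where
  "commutator a b \<equiv> a \<otimes> b \<otimes> inv a \<otimes> inv b"

context group
begin

text \<open>The form without inverses can be pushed through products, as the inductions on exponents
  below require.\<close>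

lemma commutator_eq_iff:
  assumes "a \<in> carrier G" "b \<in> carrier G" "z \<in> carrier G"
  shows "commutator a b = z \<longleftrightarrow> a \<otimes> b = z \<otimes> (b \<otimes> a)"
proof -
  have "commutator a b = (a \<otimes> b) \<otimes> inv (b \<otimes> a)"
    using assms by (simp add: inv_mult_group m_assoc)
  then show ?thesis
    using assms by (metis inv_solve_right m_closed)
qed

lemma commutator_eq_one_iff:
  assumes "a \<in> carrier G" "b \<in> carrier G"
  shows "commutator a b = \<one> \<longleftrightarrow> a \<otimes> b = b \<otimes> a"
  using assms by (simp add: commutator_eq_iff)

text \<open>Moving \<open>a\<close> past each factor \<open>b\<close> leaves one copy of the
  commutator behind, and these copies can be collected because they commute with
  \<open>b\<close>.\<close>

lemma commutator_pow_right:
  assumes a: "a \<in> carrier G" and b: "b \<in> carrier G"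
    and comm: "commutator a b \<otimes> b = b \<otimes> commutator a b"
  shows "commutator a (b [^] (n :: nat)) = commutator a b [^] n"
proof -
  define z where "z = commutator a b"
  have z: "z \<in> carrier G" using a b by (simp add: z_def)
  have ab: "a \<otimes> b = z \<otimes> (b \<otimes> a)"
    using commutator_eq_iff[OF a b z] by (simp add: z_def)
  have "a \<otimes> b [^] n = z [^] n \<otimes> (b [^] n \<otimes> a)"
  proof (induction n)
    case (Suc n)
    have "a \<otimes> b [^] Suc n = z [^] n \<otimes> (b [^] n \<otimes> (a \<otimes> b))"
      using a b z Suc by (simp add: m_assoc[symmetric])
    also have "\<dots> = z [^] n \<otimes> ((b [^] n \<otimes> z) \<otimes> (b \<otimes> a))"
      using a b z by (simp add: ab m_assoc)
    also have "b [^] n \<otimes> z = z \<otimes> b [^] n"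
      using comm b z by (intro group_commutes_pow) (simp_all add: z_def)
    finally show ?case
      using a b z by (simp add: m_assoc)
  qed (use a in simp)
  then show ?thesis
    unfolding z_def[symmetric] using a b z by (subst commutator_eq_iff) simp_all
qed

lemma commutator_pow_left:
  assumes a: "a \<in> carrier G" and b: "b \<in> carrier G"
    and comm: "commutator a b \<otimes> a = a \<otimes> commutator a b"
  shows "commutator (a [^] (n :: nat)) b = commutator a b [^] n"
proof -
  define z where "z = commutator a b"
  have z: "z \<in> carrier G" using a b by (simp add: z_def)
  have ab: "a \<otimes> b = z \<otimes> (b \<otimes> a)"
    using commutator_eq_iff[OF a b z] by (simp add: z_def)
  have "a [^] n \<otimes> b = z [^] n \<otimes> (b \<otimes> a [^] n)"
  proof (induction n)
    case (Suc n)
    have "a [^] Suc n \<otimes> b = (a [^] n \<otimes> z) \<otimes> (b \<otimes> a)"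
      using a b z by (simp add: ab m_assoc)
    also have "a [^] n \<otimes> z = z \<otimes> a [^] n"
      using comm a z by (intro group_commutes_pow) (simp_all add: z_def)
    also have "z \<otimes> a [^] n \<otimes> (b \<otimes> a) = z \<otimes> (a [^] n \<otimes> b) \<otimes> a"
      using a b z by (simp add: m_assoc)
    also have "\<dots> = z \<otimes> z [^] n \<otimes> (b \<otimes> a [^] n) \<otimes> a"
      using a b z by (simp add: Suc m_assoc)
    also have "z \<otimes> z [^] n = z [^] Suc n"
      using z by (metis nat_pow_Suc2)
    finally show ?case
      using a b z by (simp add: m_assoc)
  qed (use b in simp)
  then show ?thesis
    unfolding z_def[symmetric] using a b z by (subst commutator_eq_iff) simp_all
qed

end

lemma (in group_hom) hom_commutator:
  assumes "a \<in> carrier G" "b \<in> carrier G"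
  shows "h (G.commutator a b) = H.commutator (h a) (h b)"
  using assms by simp

section \<open>Commutators and powers modulo a normal subgroup\<close>

context normal
begin

lemma group_hom_Mod: "group_hom G (G Mod H) ((#>) H)"
  by (simp add: group_hom_def group_hom_axioms_def factorgroup_is_group r_coset_hom_Mod)

lemma r_coset_eq_self_iff:
  assumes "a \<in> carrier G"
  shows "H #> a = H \<longleftrightarrow> a \<in> H"
  using assms coset_join1 coset_join2 subgroup_axioms subset by blast

text \<open>The order of the quotient group annihilates it. For an infinite index
  \<open>card\<close> is 0, and the zeroth power is the identity.\<close>

lemma pow_index_mem:
  assumes "a \<in> carrier G"
  shows "a [^] card (rcosets H) \<in> H"
proof -
  interpret Q: group_hom G "G Mod H" "(#>) H" by (rule group_hom_Mod)
  have "H #> (a [^] order (G Mod H)) = (H #> a) [^]\<^bsub>G Mod H\<^esub> order (G Mod H)"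
    using assms by (rule Q.hom_nat_pow)
  also have "\<dots> = H"
    using Q.H.pow_order_eq_1[of "H #> a"] assms by simp
  finally show ?thesis
    using assms by (simp add: r_coset_eq_self_iff order_def FactGroup_def)
qed

lemma commutator_mem_iff:
  assumes "a \<in> carrier G" "b \<in> carrier G"
  shows "commutator a b \<in> H \<longleftrightarrow> 
    (H #> a) \<otimes>\<^bsub>G Mod H\<^esub> (H #> b) = (H #> b) \<otimes>\<^bsub>G Mod H\<^esub> (H #> a)"
proof -
  interpret Q: group_hom G "G Mod H" "(#>) H" by (rule group_hom_Mod)
  have "commutator a b \<in> H \<longleftrightarrow> H #> commutator a b = \<one>\<^bsub>G Mod H\<^esub>"
    using r_coset_eq_self_iff[of "commutator a b"] assms
    by (simp only: one_FactGroup m_closed inv_closed)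
  also have "\<dots> \<longleftrightarrow> Q.H.commutator (H #> a) (H #> b) = \<one>\<^bsub>G Mod H\<^esub>"
    unfolding Q.hom_commutator[OF assms] ..
  also have "\<dots> \<longleftrightarrow> (H #> a) \<otimes>\<^bsub>G Mod H\<^esub> (H #> b) = (H #> b) \<otimes>\<^bsub>G Mod H\<^esub> (H #> a)"
    using assms by (intro Q.H.commutator_eq_one_iff Q.hom_closed)
  finally show ?thesis .
qed

lemma commutator_mem_commute:
  assumes "a \<in> carrier G" "b \<in> carrier G"
  shows "commutator a b \<in> H \<longleftrightarrow> commutator b a \<in> H"
  using assms by (metis commutator_mem_iff)

text \<open>The set is the preimage of the centralizer of the image of \<open>b\<close> in the
  quotient.\<close>

lemma subgroup_centralizer_mod:
  assumes "b \<in> carrier G"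
  shows "subgroup {a \<in> carrier G. commutator a b \<in> H} G"
proof -
  interpret Q: group_hom G "G Mod H" "(#>) H" by (rule group_hom_Mod)
  have eq: "{a \<in> carrier G. commutator a b \<in> H} = {a \<in> carrier G.
    (H #> a) \<otimes>\<^bsub>G Mod H\<^esub> (H #> b) = (H #> b) \<otimes>\<^bsub>G Mod H\<^esub> (H #> a)}"
    using commutator_mem_iff assms by blast
  have closed: "x \<otimes>\<^bsub>G Mod H\<^esub> y \<otimes>\<^bsub>G Mod H\<^esub> z = z \<otimes>\<^bsub>G Mod H\<^esub> (x \<otimes>\<^bsub>G Mod H\<^esub> y)"
    if "x \<in> carrier (G Mod H)" "y \<in> carrier (G Mod H)" "z \<in> carrier (G Mod H)"
      "x \<otimes>\<^bsub>G Mod H\<^esub> z = z \<otimes>\<^bsub>G Mod H\<^esub> x" "y \<otimes>\<^bsub>G Mod H\<^esub> z = z \<otimes>\<^bsub>G Mod H\<^esub> y" for x y z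
    using that by (metis Q.H.m_assoc)
  have inv: "inv\<^bsub>G Mod H\<^esub> x \<otimes>\<^bsub>G Mod H\<^esub> z = z \<otimes>\<^bsub>G Mod H\<^esub> inv\<^bsub>G Mod H\<^esub> x"
    if "x \<in> carrier (G Mod H)" "z \<in> carrier (G Mod H)"
      "x \<otimes>\<^bsub>G Mod H\<^esub> z = z \<otimes>\<^bsub>G Mod H\<^esub> x" for x z
    using that by (metis Q.H.inv_closed Q.H.inv_solve_left Q.H.inv_solve_right Q.H.m_assoc Q.H.m_closed)
  show ?thesis
    unfolding eq
  proof (rule subgroupI)
    show "{a \<in> carrier G. (H #> a) \<otimes>\<^bsub>G Mod H\<^esub> (H #> b) = (H #> b) \<otimes>\<^bsub>G Mod H\<^esub> (H #> a)} \<noteq> {}"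
      using assms by blast
  next
    fix a
    assume "a \<in> {a \<in> carrier G. (H #> a) \<otimes>\<^bsub>G Mod H\<^esub> (H #> b) = (H #> b) \<otimes>\<^bsub>G Mod H\<^esub> (H #> a)}"
    then show "inv a \<in> {a \<in> carrier G. (H #> a) \<otimes>\<^bsub>G Mod H\<^esub> (H #> b) = (H #> b) \<otimes>\<^bsub>G Mod H\<^esub> (H #> a)}"
      using inv[of "H #> a" "H #> b"] assms by (simp del: mult_FactGroup)
  next
    fix a a'
    assume "a \<in> {a \<in> carrier G. (H #> a) \<otimes>\<^bsub>G Mod H\<^esub> (H #> b) = (H #> b) \<otimes>\<^bsub>G Mod H\<^esub> (H #> a)}"
      "a' \<in> {a \<in> carrier G. (H #> a) \<otimes>\<^bsub>G Mod H\<^esub> (H #> b) = (H #> b) \<otimes>\<^bsub>G Mod H\<^esub> (H #> a)}"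
    then show "a \<otimes> a' \<in> {a \<in> carrier G. (H #> a) \<otimes>\<^bsub>G Mod H\<^esub> (H #> b) = (H #> b) \<otimes>\<^bsub>G Mod H\<^esub> (H #> a)}"
      using closed[of "H #> a" "H #> a'" "H #> b"] assms by (simp del: mult_FactGroup)
  qed auto
qed

text \<open>For fixed \<open>b\<close> the elements commuting with \<open>b\<close> modulo
  \<open>H\<close> form a subgroup, so generators may be replaced by the subgroup that they
  generate, first on the left and then on the right.\<close>

lemma commutator_generate_mem:
  assumes "A \<subseteq> carrier G" "B \<subseteq> carrier G"
    and AB: "\<And>x y. x \<in> A \<Longrightarrow> y \<in> B \<Longrightarrow> commutator x y \<in> H"
    and x: "x \<in> generate G A" and y: "y \<in> generate G B"
  shows "commutator x y \<in> H"
proof -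
  have xy: "commutator a b \<in> H" if "a \<in> generate G A" "b \<in> B" for a b
  proof -
    have "b \<in> carrier G" using that assms by blast
    then have "generate G A \<subseteq> {a \<in> carrier G. commutator a b \<in> H}"
      using that assms(1) AB by (intro generate_subgroup_incl subgroup_centralizer_mod) auto
    then show ?thesis using that by blast
  qed
  have xc: "x \<in> carrier G" using x assms(1) generate_in_carrier by blast
  \<comment> \<open>The same argument with the roles exchanged, as membership of a commutator in
    \<open>H\<close> is symmetric in its two arguments.\<close>
  have "generate G B \<subseteq> {a \<in> carrier G. commutator a x \<in> H}"
  proof (intro generate_subgroup_incl subgroup_centralizer_mod xc subsetI CollectI conjI)
    fix b assume "b \<in> B"
    then show "b \<in> carrier G" "commutator b x \<in> H"
      using assms(2) xy[OF x] commutator_mem_commute xc by blast+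
  qed
  then show ?thesis
    using y xc commutator_mem_commute by blast
qed

text \<open>Elements that are central modulo \<open>H\<close> generate a subgroup that is
  commutative modulo \<open>H\<close>, on which taking \<open>e\<close>-th powers is multiplicative
  modulo \<open>H\<close>.\<close>

lemma pow_generate_mem:
  fixes e :: nat
  assumes A: "A \<subseteq> carrier G"
    and central: "\<And>x g. x \<in> A \<Longrightarrow> g \<in> carrier G \<Longrightarrow> commutator x g \<in> H"
    and pow: "\<And>x. x \<in> A \<Longrightarrow> x [^] e \<in> H"
    and a: "a \<in> generate G A"
  shows "a [^] e \<in> H"
proof -
  interpret Q: group_hom G "G Mod H" "(#>) H" by (rule group_hom_Mod)
  have AG: "x \<in> carrier G" if "x \<in> generate G A" for x
    using that A generate_in_carrier by blast
  show ?thesis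
    using a
  proof (induction rule: generate.induct)
    case one
    then show ?case by simp
  next
    case (incl x)
    then show ?case by (rule pow)
  next
    case (inv x)
    then have "inv (x [^] e) \<in> H" using pow by simp
    then show ?case using inv A by (simp add: nat_pow_inv subset_iff)
  next
    case (eng x y)
    have xy: "x \<in> carrier G" "y \<in> carrier G" using eng AG by auto
    have "commutator x y \<in> H"
      by (rule commutator_generate_mem[OF A subset_refl central eng(1)])
         (use xy in \<open>auto intro: generate.incl\<close>)
    then have "((H #> x) \<otimes>\<^bsub>G Mod H\<^esub> (H #> y)) [^]\<^bsub>G Mod H\<^esub> e =
        (H #> x) [^]\<^bsub>G Mod H\<^esub> e \<otimes>\<^bsub>G Mod H\<^esub> (H #> y) [^]\<^bsub>G Mod H\<^esub> e"
      using xy by (intro Q.H.pow_mult_distrib Q.hom_closed) (simp_all only: commutator_mem_iff)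
    then have "H #> (x \<otimes> y) [^] e = H #> (x [^] e \<otimes> y [^] e)"
      using xy by (simp add: Q.hom_nat_pow Q.hom_mult del: mult_FactGroup)
    moreover have "x [^] e \<otimes> y [^] e \<in> H" using eng by simp
    ultimately show ?case
      using xy by (metis m_closed nat_pow_closed r_coset_eq_self_iff)
  qed
qed

text \<open>Linearity in the second argument: in the quotient the commutator is central, so the
  exact power rule applies there.\<close>

lemma commutator_pow_right_mod:
  fixes n :: nat
  assumes a: "a \<in> carrier G" and b: "b \<in> carrier G"
    and central: "\<And>g. g \<in> carrier G \<Longrightarrow> commutator (commutator a b) g \<in> H"
  shows "H #> commutator a (b [^] n) = H #> commutator a b [^] n"
proof -
  interpret Q: group_hom G "G Mod H" "(#>) H" by (rule group_hom_Mod)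
  have "Q.H.commutator (H #> a) (H #> b) \<otimes>\<^bsub>G Mod H\<^esub> (H #> b) =
      (H #> b) \<otimes>\<^bsub>G Mod H\<^esub> Q.H.commutator (H #> a) (H #> b)"
    using commutator_mem_iff[of "commutator a b" b] central[OF b] a b
    by (simp only: Q.hom_commutator[symmetric]) simp
  then show ?thesis
    using a b Q.H.commutator_pow_right[of "H #> a" "H #> b" n]
    by (simp only: Q.hom_commutator Q.hom_nat_pow Q.hom_closed nat_pow_closed m_closed inv_closed)
qed

lemma commutator_pow_left_mod:
  fixes n :: nat
  assumes a: "a \<in> carrier G" and b: "b \<in> carrier G"
    and central: "\<And>g. g \<in> carrier G \<Longrightarrow> commutator (commutator a b) g \<in> H"
  shows "H #> commutator (a [^] n) b = H #> commutator a b [^] n"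
proof -
  interpret Q: group_hom G "G Mod H" "(#>) H" by (rule group_hom_Mod)
  have "Q.H.commutator (H #> a) (H #> b) \<otimes>\<^bsub>G Mod H\<^esub> (H #> a) =
      (H #> a) \<otimes>\<^bsub>G Mod H\<^esub> Q.H.commutator (H #> a) (H #> b)"
    using commutator_mem_iff[of "commutator a b" a] central[OF a] a b
    by (simp only: Q.hom_commutator[symmetric]) simp
  then show ?thesis
    using a b Q.H.commutator_pow_left[of "H #> a" "H #> b" n]
    by (simp only: Q.hom_commutator Q.hom_nat_pow Q.hom_closed nat_pow_closed m_closed inv_closed)
qed

end

section \<open>Lower central series\<close>

lemma (in group) commutator_subgroup_is_subgroup:
  assumes "A \<subseteq> carrier G" "B \<subseteq> carrier G"
  shows "subgroup (commutator_subgroup G A B) G"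
  unfolding commutator_subgroup_def using assms by (intro generate_is_subgroup) blast

lemma (in group) commutator_subgroup_mono:
  assumes "A \<subseteq> A'" "B \<subseteq> B'"
  shows "commutator_subgroup G A B \<subseteq> commutator_subgroup G A' B'"
  unfolding commutator_subgroup_def using assms by (intro mono_generate) blast

lemma (in group) commutator_in_commutator_subgroup:
  assumes "a \<in> A" "b \<in> B"
  shows "commutator a b \<in> commutator_subgroup G A B"
  unfolding commutator_subgroup_def using assms by (intro generate.incl) blast

lemma (in group) commutator_subgroup_restrict:
  assumes "subgroup H G" "A \<subseteq> H" "B \<subseteq> H"
  shows "commutator_subgroup (G\<lparr>carrier := H\<rparr>) A B = commutator_subgroup G A B"
proof -
  have "{a \<otimes> b \<otimes> inv\<^bsub>G\<lparr>carrier := H\<rparr>\<^esub> a \<otimes> inv\<^bsub>G\<lparr>carrier := H\<rparr>\<^esub> b | a b. a \<in> A \<and> b \<in> B} =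
      {commutator a b | a b. a \<in> A \<and> b \<in> B}" (is "?L = ?R")
  proof -
    have eq: "a \<otimes> b \<otimes> inv\<^bsub>G\<lparr>carrier := H\<rparr>\<^esub> a \<otimes> inv\<^bsub>G\<lparr>carrier := H\<rparr>\<^esub> b = commutator a b"
      if "a \<in> A" "b \<in> B" for a b
      using that assms(2,3) m_inv_consistent[OF assms(1), of a] m_inv_consistent[OF assms(1), of b]
      by (simp only: subsetD)
    show ?thesis by (intro Collect_cong ex_cong1) (use eq in metis)
  qed
  moreover have "?R \<subseteq> H"
    using assms by (blast intro: subgroup.m_closed subgroup.m_inv_closed)
  ultimately show ?thesis
    unfolding commutator_subgroup_def using generate_consistent[OF _ assms(1), of ?R] by simp
qed

lemma (in group_hom) commutator_subgroup_img:
  assumes "A \<subseteq> carrier G" "B \<subseteq> carrier G"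
  shows "h ` commutator_subgroup G A B = commutator_subgroup H (h ` A) (h ` B)"
proof -
  let ?L = "{G.commutator a b | a b. a \<in> A \<and> b \<in> B}"
    and ?R = "{H.commutator a b | a b. a \<in> h ` A \<and> b \<in> h ` B}"
  have eq: "h (G.commutator a b) = H.commutator (h a) (h b)" if "a \<in> A" "b \<in> B" for a b
    using that assms by (intro hom_commutator) auto
  have "h ` ?L = ?R"
  proof
    show "h ` ?L \<subseteq> ?R"
    proof clarify
      fix a b assume ab: "a \<in> A" "b \<in> B"
      show "\<exists>a' b'. h (G.commutator a b) = H.commutator a' b' \<and> a' \<in> h ` A \<and> b' \<in> h ` B"
        by (rule exI[of _ "h a"], rule exI[of _ "h b"]) (simp only: eq[OF ab] imageI ab simp_thms)
    qed
    show "?R \<subseteq> h ` ?L"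
    proof clarify
      fix a b assume ab: "a \<in> A" "b \<in> B"
      show "H.commutator (h a) (h b) \<in> h ` ?L"
        unfolding eq[OF ab, symmetric] using ab by (intro imageI) blast
    qed
  qed
  moreover have "?L \<subseteq> carrier G"
    using assms by (blast intro: G.m_closed G.inv_closed)
  ultimately show ?thesis
    unfolding commutator_subgroup_def using generate_img[of ?L] by simp
qed

lemma lower_central_one [simp]: "lower_central G (Suc 0) = carrier G"
  by (simp add: lower_central_def)

text \<open>The recursion starts at index 1, since the indices 0 and 1 both give the whole
  group.\<close>

lemma lower_central_Suc:
  assumes "m \<ge> 1"
  shows "lower_central G (Suc m) = commutator_subgroup G (lower_central G m) (carrier G)"
  using assms by (cases m) (simp_all add: lower_central_def)

lemma (in group) lower_central_subgroup: "subgroup (lower_central G m) G"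
proof (induction m rule: nat_induct)
  case 0
  then show ?case by (simp add: lower_central_def subgroup_self)
next
  case (Suc m)
  then show ?case
    by (cases "m = 0") (simp_all add: subgroup_self lower_central_Suc subgroup.subset
      commutator_subgroup_is_subgroup)
qed

lemma (in group) lower_central_subset: "lower_central G m \<subseteq> carrier G"
  by (rule subgroup.subset[OF lower_central_subgroup])

lemma (in group_hom) lower_central_img_subset:
  "h ` lower_central G m \<subseteq> lower_central H m"
proof (induction m)
  case 0
  then show ?case by (auto simp: lower_central_def)
next
  case (Suc m)
  show ?case
  proof (cases "m = 0")
    case False
    then have "h ` lower_central G (Suc m) =
        commutator_subgroup H (h ` lower_central G m) (h ` carrier G)"
      using G.lower_central_subset by (simp add: lower_central_Suc commutator_subgroup_img)
    also have "\<dots> \<subseteq> commutator_subgroup H (lower_central H m) (carrier H)"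
      by (intro H.commutator_subgroup_mono Suc) auto
    finally show ?thesis
      using False by (simp add: lower_central_Suc)
  qed auto
qed

lemma (in group_hom) lower_central_img:
  assumes "h ` carrier G = carrier H"
  shows "h ` lower_central G m = lower_central H m"
proof (induction m)
  case 0
  then show ?case using assms by (simp add: lower_central_def)
next
  case (Suc m)
  then show ?case
    using assms G.lower_central_subset
    by (cases "m = 0") (simp_all add: lower_central_Suc commutator_subgroup_img)
qed

lemma (in group) lower_central_restrict_Suc:
  assumes "subgroup A G" "m \<ge> 1"
  shows "lower_central (G\<lparr>carrier := A\<rparr>) (Suc m) =
    commutator_subgroup G (lower_central (G\<lparr>carrier := A\<rparr>) m) A"
  using assms group.lower_central_subset[OF subgroup_imp_group[OF assms(1)], of m]
  by (simp add: lower_central_Suc commutator_subgroup_restrict)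

lemma (in group) conj_mult:
  assumes "g \<in> carrier G" "x \<in> carrier G" "y \<in> carrier G"
  shows "g \<otimes> (x \<otimes> y) \<otimes> inv g = (g \<otimes> x \<otimes> inv g) \<otimes> (g \<otimes> y \<otimes> inv g)"
proof -
  have "inv g \<otimes> (g \<otimes> (y \<otimes> inv g)) = y \<otimes> inv g"
    using assms by (simp flip: m_assoc)
  then show ?thesis
    using assms by (simp add: m_assoc)
qed

text \<open>Conjugation by \<open>g\<close> restricts to an endomorphism of \<open>A\<close>, and
  homomorphisms respect the lower central series.\<close>

lemma (in group) lower_central_restrict_normal:
  assumes "A \<lhd> G"
  shows "lower_central (G\<lparr>carrier := A\<rparr>) m \<lhd> G"
proof (rule normal_invI)
  interpret A: normal A G by (rule assms)
  interpret GA: group "G\<lparr>carrier := A\<rparr>"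
    by (rule subgroup_imp_group[OF A.subgroup_axioms])
  show "subgroup (lower_central (G\<lparr>carrier := A\<rparr>) m) G"
    using GA.lower_central_subgroup A.subgroup_axioms incl_subgroup by blast
  fix g a assume g: "g \<in> carrier G" and a: "a \<in> lower_central (G\<lparr>carrier := A\<rparr>) m"
  interpret c: group_hom "G\<lparr>carrier := A\<rparr>" "G\<lparr>carrier := A\<rparr>" "\<lambda>x. g \<otimes> x \<otimes> inv g"
  proof (intro group_hom.intro group_hom_axioms.intro GA.group_axioms homI)
    fix x y assume "x \<in> carrier (G\<lparr>carrier := A\<rparr>)" "y \<in> carrier (G\<lparr>carrier := A\<rparr>)"
    then have "x \<in> A" "y \<in> A" by simp_all
    then show "g \<otimes> x \<otimes> inv g \<in> carrier (G\<lparr>carrier := A\<rparr>)"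
      using A.inv_op_closed2[OF g] by simp
    show "g \<otimes> (x \<otimes>\<^bsub>G\<lparr>carrier := A\<rparr>\<^esub> y) \<otimes> inv g =
        (g \<otimes> x \<otimes> inv g) \<otimes>\<^bsub>G\<lparr>carrier := A\<rparr>\<^esub> (g \<otimes> y \<otimes> inv g)"
      using conj_mult[OF g A.mem_carrier A.mem_carrier] \<open>x \<in> A\<close> \<open>y \<in> A\<close> by simp
  qed
  show "g \<otimes> a \<otimes> inv g \<in> lower_central (G\<lparr>carrier := A\<rparr>) m"
    using c.lower_central_img_subset a by blast
qed

lemma (in group) lower_central_normal: "lower_central G m \<lhd> G"
  using lower_central_restrict_normal[of "carrier G" m] normal_self by simp

lemma (in group) commutator_in_lower_central:
  assumes "m \<ge> 1" "a \<in> lower_central G m" "b \<in> carrier G"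
  shows "commutator a b \<in> lower_central G (Suc m)"
  using assms by (simp add: lower_central_Suc commutator_in_commutator_subgroup)

lemma (in group) lower_central_Suc_subset: "lower_central G (Suc m) \<subseteq> lower_central G m"
proof (cases "m = 0")
  case False
  interpret normal "lower_central G m" G by (rule lower_central_normal)
  have "{commutator a b | a b. a \<in> lower_central G m \<and> b \<in> carrier G} \<subseteq> lower_central G m"
  proof clarify
    fix a b assume "a \<in> lower_central G m" "b \<in> carrier G"
    moreover from this have "b \<otimes> inv a \<otimes> inv b \<in> lower_central G m"
      by (intro inv_op_closed2) auto
    ultimately have "a \<otimes> (b \<otimes> inv a \<otimes> inv b) \<in> lower_central G m" by simp
    then show "commutator a b \<in> lower_central G m"
      using \<open>a \<in> _\<close> \<open>b \<in> _\<close> by (simp add: m_assoc)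
  qed
  then show ?thesis
    using False
    by (simp add: lower_central_Suc commutator_subgroup_def generate_subgroup_incl subgroup_axioms)
qed (simp add: lower_central_def)

lemma (in group) lower_central_antimono:
  "m \<le> n \<Longrightarrow> lower_central G n \<subseteq> lower_central G m"
  by (rule lift_Suc_antimono_le[of "lower_central G"]) (rule lower_central_Suc_subset)

section \<open>Exponents of the lower central factors\<close>

context group
begin

text \<open>Modulo \<open>\<gamma>\<^sub>m\<^sub>+\<^sub>2\<close>, the \<open>e\<close>-th power of
  a commutator of \<open>c\<close> and \<open>b\<close> is the commutator of \<open>c [^] e\<close>
  and \<open>b\<close>, which is trivial because \<open>c [^] e\<close> lies in
  \<open>\<gamma>\<^sub>m\<^sub>+\<^sub>1\<close>. The generators are central there, so the
  conclusion extends to all products.\<close>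

lemma lower_central_pow_Suc:
  fixes e :: nat
  assumes m: "m \<ge> 1"
    and pow: "\<And>a. a \<in> lower_central G m \<Longrightarrow> a [^] e \<in> lower_central G (Suc m)"
    and a: "a \<in> lower_central G (Suc m)"
  shows "a [^] e \<in> lower_central G (Suc (Suc m))"
proof -
  interpret N: normal "lower_central G (Suc (Suc m))" G by (rule lower_central_normal)
  have central: "commutator c g \<in> lower_central G (Suc (Suc m))"
    if "c \<in> lower_central G (Suc m)" "g \<in> carrier G" for c g
    using that m by (intro commutator_in_lower_central) auto
  show ?thesis
  proof (rule N.pow_generate_mem)
    show "a \<in> generate G {commutator a b | a b. a \<in> lower_central G m \<and> b \<in> carrier G}"
      using a unfolding lower_central_Suc[OF m] commutator_subgroup_def .
    show "{commutator a b | a b. a \<in> lower_central G m \<and> b \<in> carrier G} \<subseteq> carrier G"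
      using lower_central_subset[of m] by (blast intro: m_closed inv_closed)
  next
    fix x g assume "x \<in> {commutator a b | a b. a \<in> lower_central G m \<and> b \<in> carrier G}"
      and g: "g \<in> carrier G"
    then show "commutator x g \<in> lower_central G (Suc (Suc m))"
      using central[OF commutator_in_lower_central[OF m]] by blast
  next
    fix x assume "x \<in> {commutator a b | a b. a \<in> lower_central G m \<and> b \<in> carrier G}"
    then obtain c b where x: "x = commutator c b" and c: "c \<in> lower_central G m"
      and b: "b \<in> carrier G" by blast
    have cc: "c \<in> carrier G" using lower_central_subset c by blast
    have "lower_central G (Suc (Suc m)) #> x [^] e =
        lower_central G (Suc (Suc m)) #> commutator (c [^] e) b"
      unfolding x using N.commutator_pow_left_mod[OF cc b, of e] central[OF commutator_in_lower_central[OF m c b]]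
      by simp
    also have "\<dots> = lower_central G (Suc (Suc m))"
      using central[OF pow[OF c] b] cc b by (subst N.r_coset_eq_self_iff) auto
    finally show "x [^] e \<in> lower_central G (Suc (Suc m))"
      using cc b by (subst (asm) N.r_coset_eq_self_iff) (auto simp: x)
  qed
qed

text \<open>Linearity in both arguments: one factor \<open>e\<close> of the exponent moves into each
  entry of the commutator.\<close>

lemma lower_central_pow_two:
  fixes e :: nat
  assumes pow: "\<And>a b. a \<in> carrier G \<Longrightarrow> b \<in> carrier G \<Longrightarrow>
      commutator (a [^] e) (b [^] e) \<in> lower_central G 3"
    and a: "a \<in> lower_central G 2"
  shows "a [^] (e * e) \<in> lower_central G 3"
proof -
  interpret N: normal "lower_central G 3" G by (rule lower_central_normal)
  interpret Q: group_hom G "G Mod lower_central G 3" "(#>) (lower_central G 3)"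
    by (rule N.group_hom_Mod)
  have two: "commutator c g \<in> lower_central G 2"
    if "c \<in> carrier G" "g \<in> carrier G" for c g
    using that commutator_in_lower_central[of 1 c g] by (simp add: numeral_2_eq_2)
  have central: "commutator c g \<in> lower_central G 3"
    if "c \<in> lower_central G 2" "g \<in> carrier G" for c g
    using that commutator_in_lower_central[of 2 c g] by (simp add: numeral_3_eq_3 numeral_2_eq_2)
  show ?thesis
  proof (rule N.pow_generate_mem)
    show "a \<in> generate G {commutator a b | a b. a \<in> carrier G \<and> b \<in> carrier G}"
      using a lower_central_Suc[of 1 G] by (simp add: numeral_2_eq_2 commutator_subgroup_def)
    show "{commutator a b | a b. a \<in> carrier G \<and> b \<in> carrier G} \<subseteq> carrier G"
      by auto
  next
    fix x g assume "x \<in> {commutator a b | a b. a \<in> carrier G \<and> b \<in> carrier G}"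
      and g: "g \<in> carrier G"
    then show "commutator x g \<in> lower_central G 3"
      using central[OF two] by blast
  next
    fix x assume "x \<in> {commutator a b | a b. a \<in> carrier G \<and> b \<in> carrier G}"
    then obtain c b where x: "x = commutator c b" and c: "c \<in> carrier G"
      and b: "b \<in> carrier G" by blast
    let ?N = "lower_central G 3"
    have "?N #> x [^] (e * e) = ?N #> (x [^] e) [^] e"
      using c b by (simp add: x nat_pow_pow)
    also have "\<dots> = (?N #> x [^] e) [^]\<^bsub>G Mod ?N\<^esub> e"
      using c b by (intro Q.hom_nat_pow) (simp add: x)
    also have "?N #> x [^] e = ?N #> commutator c (b [^] e)"
      unfolding x using N.commutator_pow_right_mod[OF c b, of e] central[OF two[OF c b]] by simp
    also have "(?N #> commutator c (b [^] e)) [^]\<^bsub>G Mod ?N\<^esub> e = ?N #> commutator c (b [^] e) [^] e"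
      using c b by (intro Q.hom_nat_pow[symmetric]) simp
    also have "\<dots> = ?N #> commutator (c [^] e) (b [^] e)"
      using N.commutator_pow_left_mod[OF c nat_pow_closed[OF b], of e]
        central[OF two[OF c nat_pow_closed[OF b]]] by simp
    also have "\<dots> = ?N"
      using pow[OF c b] c b by (subst N.r_coset_eq_self_iff) auto
    finally show "x [^] (e * e) \<in> ?N"
      using c b by (subst (asm) N.r_coset_eq_self_iff) (auto simp: x)
  qed
qed

text \<open>An exponent of one factor is passed on to all later ones, so each \<open>e\<close>-th
  power descends one step until the series reaches the identity.\<close>

lemma nilpotent_exponent:
  fixes e :: nat
  assumes nil: "nilpotent_group G" and m: "m \<ge> 1"
    and pow: "\<And>a. a \<in> lower_central G m \<Longrightarrow> a [^] e \<in> lower_central G (Suc m)"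
  obtains k where "\<And>a. a \<in> lower_central G m \<Longrightarrow> a [^] (e ^ k) = \<one>"
proof -
  obtain c where c: "lower_central G c = {\<one>}"
    using nil unfolding nilpotent_group_def by blast
  have step: "a [^] e \<in> lower_central G (Suc (m + k))" if "a \<in> lower_central G (m + k)" for a k
    using that
  proof (induction k arbitrary: a)
    case 0
    then show ?case using pow by simp
  next
    case (Suc k)
    then show ?case
      using m lower_central_pow_Suc[of "m + k" e a] by simp
  qed
  have "a [^] (e ^ k) \<in> lower_central G (m + k)" if a: "a \<in> lower_central G m" for a k
  proof (induction k)
    case 0
    then show ?case using a lower_central_subset by (auto simp: subset_iff)
  next
    case (Suc k)
    have "a [^] (e ^ Suc k) = (a [^] (e ^ k)) [^] e"
      using a lower_central_subset[of m] by (simp add: nat_pow_pow subset_iff mult.commute)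
    then show ?case using step[OF Suc] by simp
  qed
  moreover have "lower_central G (m + c) \<subseteq> {\<one>}"
    using lower_central_antimono[of c "m + c"] c by simp
  ultimately have "a [^] (e ^ c) = \<one>" if "a \<in> lower_central G m" for a
    using that by blast
  then show thesis by (rule that)
qed

text \<open>The order of \<open>y\<close> divides a power of \<open>e\<close>. This turns torsion
  deep in the series into divisibility of any exponent of an earlier factor.\<close>

lemma prime_dvd_exponent:
  fixes e :: nat
  assumes "nilpotent_group G" "m \<ge> 1"
    and "\<And>a. a \<in> lower_central G m \<Longrightarrow> a [^] e \<in> lower_central G (Suc m)"
    and y: "y \<in> lower_central G m" and p: "Factorial_Ring.prime p" "p dvd ord y"
  shows "p dvd e"
proof -
  obtain k where "\<And>a. a \<in> lower_central G m \<Longrightarrow> a [^] (e ^ k) = \<one>"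
    using nilpotent_exponent assms(1-3) by blast
  then have "ord y dvd e ^ k"
    using y pow_eq_id lower_central_subset by blast
  then have "p dvd e ^ k" using p(2) by (rule dvd_trans[rotated])
  then show ?thesis using p(1) prime_dvd_power by blast
qed

text \<open>Take \<open>e\<close> to be the index, which annihilates the factor group by Lagrange's
  theorem.\<close>

lemma lower_central_factor_exponent:
  obtains e where "card (lower_central G m) = e * card (lower_central G (Suc m))"
    "\<And>a. a \<in> lower_central G m \<Longrightarrow> a [^] e \<in> lower_central G (Suc m)"
proof -
  let ?L = "G\<lparr>carrier := lower_central G m\<rparr>"
  interpret L: group ?L by (rule subgroup_imp_group[OF lower_central_subgroup])
  interpret N: normal "lower_central G (Suc m)" ?L
    by (intro normal_restrict_supergroup lower_central_subgroup lower_central_normal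
        lower_central_Suc_subset)
  show thesis
  proof (rule that)
    show "card (lower_central G m) = card (rcosets\<^bsub>?L\<^esub> (lower_central G (Suc m))) * card (lower_central G (Suc m))"
      using L.lagrange[OF N.subgroup_axioms] by (simp add: order_def)
    show "a [^] card (rcosets\<^bsub>?L\<^esub> (lower_central G (Suc m))) \<in> lower_central G (Suc m)"
      if "a \<in> lower_central G m" for a
      using N.pow_index_mem[of a] that by (simp flip: nat_pow_consistent)
  qed
qed

text \<open>If \<open>p\<close> does not divide the index of \<open>\<gamma>\<^sub>i\<^sub>+\<^sub>1\<close> in \<open>\<gamma>\<^sub>i\<close>, then by bilinearity of commutators the
  exponents of all further factors, hence that of \<open>\<gamma>\<^sub>i\<close>, are prime to \<open>p\<close>.\<close>

lemma prime_dvd_lower_central_factor: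
  assumes "nilpotent_group G" "1 \<le> i" "i \<le> m"
    and y: "y \<in> lower_central G m" and p: "Factorial_Ring.prime p" "p dvd ord y"
  shows "p * card (lower_central G (Suc i)) dvd card (lower_central G i)"
proof -
  obtain e where e: "card (lower_central G i) = e * card (lower_central G (Suc i))"
    "\<And>a. a \<in> lower_central G i \<Longrightarrow> a [^] e \<in> lower_central G (Suc i)"
    using lower_central_factor_exponent by blast
  moreover have "p dvd e"
    using prime_dvd_exponent[OF assms(1,2) e(2) _ p] y lower_central_antimono[OF assms(3)] by blast
  ultimately show ?thesis by (simp add: mult_dvd_mono)
qed

end

section \<open>Prime powers dividing the order of a nilpotent group, and products of normal
  nilpotent subgroups\<close>

context group
begin

lemma commutator_in_normal_left:
  assumes "N \<lhd> G" "a \<in> N" "b \<in> carrier G"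
  shows "commutator a b \<in> N"
proof -
  interpret normal N G by (rule assms(1))
  have "a \<otimes> (b \<otimes> inv a \<otimes> inv b) \<in> N"
    using assms inv_op_closed2 by simp
  then show ?thesis using assms by (simp add: m_assoc)
qed

lemma commutator_in_normal_right:
  assumes "N \<lhd> G" "a \<in> carrier G" "b \<in> N"
  shows "commutator a b \<in> N"
proof -
  interpret normal N G by (rule assms(1))
  show ?thesis
    using commutator_in_normal_left[OF assms(1,3,2)] assms commutator_mem_commute mem_carrier by blast
qed

text \<open>Suppose that the index of \<open>\<gamma>\<^sub>2\<close> is \<open>p e\<close> with \<open>e\<close> prime to \<open>p\<close>. An element \<open>u\<close> of order \<open>p\<close> modulo \<open>\<gamma>\<^sub>2\<close>
  generates a subgroup \<open>U\<close> over \<open>\<gamma>\<^sub>2\<close> which contains all \<open>e\<close>-th powers and is commutative modulo \<open>\<gamma>\<^sub>3\<close>, so that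
  \<open>[a, b] ^ (e\<^sup>2) = [a ^ e, b ^ e] = 1\<close> modulo \<open>\<gamma>\<^sub>3\<close>.\<close>

lemma prime_square_dvd_abelianization:
  assumes fin: "finite (carrier G)" and nil: "nilpotent_group G" and m: "2 \<le> m"
    and y: "y \<in> lower_central G m" and p: "Factorial_Ring.prime p" "p dvd ord y"
  shows "p ^ 2 * card (lower_central G 2) dvd order G"
proof -
  have y2: "y \<in> lower_central G 2" using y m lower_central_antimono by blast
  have y1: "y \<in> lower_central G 1" using y2 lower_central_antimono[of 1 2] by auto
  interpret N: normal "lower_central G 2" G by (rule lower_central_normal)
  interpret M: normal "lower_central G 3" G by (rule lower_central_normal)
  interpret Q: group_hom G "G Mod lower_central G 2" "(#>) (lower_central G 2)"
    by (rule N.group_hom_Mod)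
  obtain e0 where e0: "order G = e0 * card (lower_central G 2)"
    and pow0: "\<And>a. a \<in> carrier G \<Longrightarrow> a [^] e0 \<in> lower_central G 2"
    using lower_central_factor_exponent[of 1] by (auto simp: order_def numeral_2_eq_2)
  have dvd1: "p dvd e" if "\<And>a. a \<in> carrier G \<Longrightarrow> a [^] e \<in> lower_central G 2" for e :: nat
    using prime_dvd_exponent[OF nil, of 1 e y p] y1 p that by (simp add: numeral_2_eq_2)
  obtain e where e: "e0 = p * e" using dvd1[OF pow0] by blast
  have "p dvd e"
  \<comment> \<open>If \<open>e\<close> itself annihilates the abelianization, the exponent
    criterion gives the claim at once; otherwise some \<open>e\<close>-th power has order
    \<open>p\<close> modulo \<open>\<gamma>\<^sub>2\<close>.\<close>
  proof (cases "\<forall>a \<in> carrier G. a [^] e \<in> lower_central G 2")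
    case True
    then show ?thesis using dvd1 by blast
  next
    case False
    then obtain b where b: "b \<in> carrier G" "b [^] e \<notin> lower_central G 2" by blast
    define u where "u = b [^] e"
    have u: "u \<in> carrier G" "u \<notin> lower_central G 2" using b by (simp_all add: u_def)
    have up: "u [^] p \<in> lower_central G 2"
      using pow0[OF b(1)] b by (simp add: u_def e nat_pow_pow mult.commute)
    define U where "U = generate G (insert u (lower_central G 2))"
    have sub: "insert u (lower_central G 2) \<subseteq> carrier G" using u lower_central_subset by blast
    have NU: "lower_central G 2 \<subseteq> U" "u \<in> U" by (auto simp: U_def intro: generate.incl)
    have U: "subgroup U G" unfolding U_def by (rule generate_is_subgroup[OF sub])
    have "U \<lhd> G"
    proof (rule normal_invI[OF U])
      fix g a assume ga: "g \<in> carrier G" "a \<in> U"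
      then have a: "a \<in> carrier G" using subgroup.mem_carrier[OF U] by blast
      have "commutator g a \<in> U"
        using commutator_in_lower_central[of 1 g a] ga a NU by (auto simp: numeral_2_eq_2)
      then have "commutator g a \<otimes> a \<in> U" using ga subgroup.m_closed[OF U] by blast
      then show "g \<otimes> a \<otimes> inv g \<in> U" using ga a by (simp add: m_assoc)
    qed
    then interpret U: normal U G .
    let ?U = "G\<lparr>carrier := U\<rparr>"
    interpret GU: group ?U by (rule subgroup_imp_group[OF U])
    interpret NU: normal "lower_central G 2" ?U
      by (intro normal_restrict_supergroup U lower_central_normal NU)
    define k where "k = card (rcosets\<^bsub>?U\<^esub> (lower_central G 2))"
    define f where "f = card (rcosets U)"
    have k: "card U = k * card (lower_central G 2)"
      using GU.lagrange[OF NU.subgroup_axioms] by (simp add: order_def k_def)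
    have f: "order G = f * card U"
      using lagrange[OF U] by (simp add: f_def)
    \<comment> \<open>Finiteness permits cancelling this cardinality, so that \<open>p * e\<close>
      and \<open>f * k\<close> are both the index of \<open>\<gamma>\<^sub>2\<close>.\<close>
    have "card (lower_central G 2) \<noteq> 0"
      using finite_subset[OF lower_central_subset fin] N.one_closed by (metis card_0_eq empty_iff)
    then have pe: "p * e = f * k" using e0 f k e by simp
    have uk: "u [^] k \<in> lower_central G 2"
      using NU.pow_index_mem[of u] NU(2) by (simp add: k_def flip: nat_pow_consistent)
    have quot: "Q.H.ord (lower_central G 2 #> u) dvd n" if "u [^] n \<in> lower_central G 2" for n :: nat
    proof -
      have "(lower_central G 2 #> u) [^]\<^bsub>G Mod lower_central G 2\<^esub> n = lower_central G 2"
        using that u N.r_coset_eq_self_iff[of "u [^] n"] Q.hom_nat_pow[of u n] by simp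
      then show ?thesis using Q.H.pow_eq_id[of "lower_central G 2 #> u" n] u by simp
    qed
    \<comment> \<open>The order of \<open>u\<close> modulo \<open>\<gamma>\<^sub>2\<close> divides
      both \<open>p\<close> and \<open>k\<close>; if these were coprime, \<open>u\<close> would lie
      in \<open>\<gamma>\<^sub>2\<close>.\<close>
    have "p dvd k"
    proof (rule ccontr)
      assume "\<not> p dvd k"
      then have "coprime p k" using p(1) by (simp add: prime_imp_coprime)
      then have "Q.H.ord (lower_central G 2 #> u) dvd 1"
        using quot[OF up] quot[OF uk] by (metis coprime_def)
      then have "(lower_central G 2 #> u) [^]\<^bsub>G Mod lower_central G 2\<^esub> (1 :: nat) = lower_central G 2"
        using Q.H.pow_eq_id[of "lower_central G 2 #> u" 1] u by simp
      then show False using u N.r_coset_eq_self_iff[of u] Q.H.nat_pow_eone[of "lower_central G 2 #> u"] by simp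
    qed
    then obtain k' where "k = p * k'" by blast
    then have "e = f * k'" using pe p(1) by (simp add: prime_gt_0_nat)
    \<comment> \<open>The index \<open>f\<close> of \<open>U\<close> divides \<open>e\<close>, and
      \<open>f\<close>-th powers lie in \<open>U\<close>.\<close>
    then have eU: "a [^] e \<in> U" if "a \<in> carrier G" for a
    proof -
      have "(a [^] f) [^] k' \<in> U"
        using GU.nat_pow_closed[of "a [^] f" k'] U.pow_index_mem[OF that]
        by (simp add: f_def flip: nat_pow_consistent)
      then show ?thesis using that \<open>e = f * k'\<close> by (simp add: nat_pow_pow)
    qed
    \<comment> \<open>It suffices to check generators: \<open>u\<close> commutes with itself, and
      \<open>\<gamma>\<^sub>2\<close> is central modulo \<open>\<gamma>\<^sub>3\<close>.\<close>
    have comm: "commutator a c \<in> lower_central G 3" if "a \<in> U" "c \<in> U" for a c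
    proof (rule M.commutator_generate_mem[OF sub sub _ that[unfolded U_def]])
      fix s t assume st: "s \<in> insert u (lower_central G 2)" "t \<in> insert u (lower_central G 2)"
      have *: "commutator s t \<in> lower_central G 3" if "s \<in> lower_central G 2" "t \<in> carrier G" for s t
        using commutator_in_lower_central[of 2 s t] that by (simp add: numeral_3_eq_3 numeral_2_eq_2)
      have stc: "s \<in> carrier G" "t \<in> carrier G" using st sub by auto
      show "commutator s t \<in> lower_central G 3"
      proof (cases "s = u \<and> t = u")
        case True
        then show ?thesis using u by (simp add: m_assoc)
      next
        case False
        then show ?thesis
          using st stc *[of s t] *[of t s] M.commutator_mem_commute[OF stc] by blast
      qed
    qed
    have "\<And>a. a \<in> lower_central G 2 \<Longrightarrow> a [^] (e * e) \<in> lower_central G 3"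
      by (rule lower_central_pow_two[OF comm[OF eU eU]])
    \<comment> \<open>The exponent criterion is applied again, now to the factor of
      \<open>\<gamma>\<^sub>2\<close> by \<open>\<gamma>\<^sub>3\<close>; this is where
      \<open>y\<close> has to lie in \<open>\<gamma>\<^sub>2\<close>.\<close>
    then have "p dvd e * e"
      using prime_dvd_exponent[OF nil, of 2 "e * e" y p] y2 p by (simp add: numeral_3_eq_3 numeral_2_eq_2)
    then show ?thesis using p(1) by (simp add: prime_dvd_mult_iff)
  qed
  then have "p * p dvd e0" by (simp add: e)
  then show ?thesis by (simp add: e0 power2_eq_square mult_dvd_mono)
qed

text \<open>The first factor contributes \<open>p ^ 2\<close>, and each of the \<open>m - 1\<close>
  following ones contributes another \<open>p\<close>.\<close>

theorem prime_power_dvd_order: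
  assumes fin: "finite (carrier G)" and nil: "nilpotent_group G" and m: "2 \<le> m"
    and y: "y \<in> lower_central G m" and p: "Factorial_Ring.prime p" "p dvd ord y"
  shows "p ^ (m + 1) dvd order G"
proof -
  have "k \<ge> 1 \<Longrightarrow> k \<le> m \<Longrightarrow> p ^ Suc k * card (lower_central G (Suc k)) dvd order G" for k
  proof (induction k rule: nat_induct_at_least)
    case base
    then show ?case
      using prime_square_dvd_abelianization[OF fin nil m y p] by (simp add: numeral_2_eq_2)
  next
    case (Suc k)
    have "p ^ Suc k * (p * card (lower_central G (Suc (Suc k)))) dvd
        p ^ Suc k * card (lower_central G (Suc k))"
      using Suc.prems Suc.hyps
      by (intro mult_dvd_mono prime_dvd_lower_central_factor[OF nil _ _ y p]) auto
    also have "\<dots> dvd order G" using Suc by simp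
    finally show ?case by (simp add: mult_ac)
  qed
  from this[of m] m show ?thesis by (auto dest: dvd_mult_left)
qed

text \<open>Fitting's theorem, by means of the filtration \<open>D\<^sub>n\<close> generated by all \<open>\<gamma>\<^sub>i(A) \<inter> \<gamma>\<^sub>j(B)\<close> with \<open>i + j = n\<close>,
  where \<open>\<gamma>\<^sub>0\<close> is taken to be the whole group.\<close>

theorem fitting:
  assumes A: "A \<lhd> G" "nilpotent_group (G\<lparr>carrier := A\<rparr>)"
    and B: "B \<lhd> G" "nilpotent_group (G\<lparr>carrier := B\<rparr>)"
  obtains F where "F \<lhd> G" "nilpotent_group (G\<lparr>carrier := F\<rparr>)" "A \<subseteq> F" "B \<subseteq> F"
proof -
  \<comment> \<open>With the whole group at index 0, a commutator with an element of
    \<open>K\<close> raises the index even from 0 to 1, because \<open>K\<close> is normal.\<close>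
  define l where "l K i = (if i = 0 then carrier G else lower_central (G\<lparr>carrier := K\<rparr>) i)" for K i
  have l_normal: "l K i \<lhd> G" if "K \<lhd> G" for K i
    using lower_central_restrict_normal[OF that] normal_self by (simp add: l_def)
  have l_comm: "commutator a b \<in> l K (Suc i)" if K: "K \<lhd> G" and "a \<in> l K i" "b \<in> K" for K i a b
  proof (cases "i = 0")
    case True
    then show ?thesis using that commutator_in_normal_right by (simp add: l_def)
  next
    case False
    then show ?thesis
      using that lower_central_restrict_Suc[OF normal_imp_subgroup[OF K], of i]
        commutator_in_commutator_subgroup by (simp add: l_def)
  qed
  have l_triv: "\<exists>c. \<forall>i\<ge>c. l K i \<subseteq> {\<one>}" if K: "K \<lhd> G" "nilpotent_group (G\<lparr>carrier := K\<rparr>)" for K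
  proof -
    interpret K: group "G\<lparr>carrier := K\<rparr>" by (rule subgroup_imp_group[OF normal_imp_subgroup[OF K(1)]])
    obtain c where "c \<ge> 1" "lower_central (G\<lparr>carrier := K\<rparr>) c = {\<one>}"
      using K(2) by (auto simp: nilpotent_group_def)
    then have "\<forall>i\<ge>c. l K i \<subseteq> {\<one>}"
      using K.lower_central_antimono[of c] by (auto simp: l_def)
    then show ?thesis by blast
  qed
  obtain a b where triv: "\<And>i. i \<ge> a \<Longrightarrow> l A i \<subseteq> {\<one>}" "\<And>i. i \<ge> b \<Longrightarrow> l B i \<subseteq> {\<one>}"
    using l_triv[OF A] l_triv[OF B] by blast
  define g where "g n = (\<Union>i\<le>n. l A i \<inter> l B (n - i))" for n
  define D where "D n = generate G (g n)" for n
  have g_carrier: "g n \<subseteq> carrier G" for n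
    using l_normal[OF A(1)] normal_imp_subgroup subgroup.subset by (fastforce simp: g_def)
  have D_normal: "D n \<lhd> G" for n
    unfolding D_def
  proof (rule normal_generateI[OF g_carrier])
    fix h x assume "h \<in> g n" and x: "x \<in> carrier G"
    then obtain i where i: "i \<le> n" "h \<in> l A i" "h \<in> l B (n - i)" by (auto simp: g_def)
    then have "x \<otimes> h \<otimes> inv x \<in> l A i \<inter> l B (n - i)"
      using normal_invE(2)[OF l_normal[OF A(1)]] normal_invE(2)[OF l_normal[OF B(1)]] x by blast
    then show "x \<otimes> h \<otimes> inv x \<in> g n" using i(1) by (auto simp: g_def)
  qed
  have g1: "g 1 = A \<union> B"
  proof -
    have "A \<subseteq> carrier G" "B \<subseteq> carrier G"
      using A(1) B(1) normal_imp_subgroup subgroup.subset by blast+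
    moreover have "{..1 :: nat} = {0, 1}" by auto
    ultimately show ?thesis by (auto simp: g_def l_def)
  qed
  define F where "F = D 1"
  have F: "F \<lhd> G" by (simp add: F_def D_normal)
  have AB: "A \<subseteq> F" "B \<subseteq> F" unfolding F_def D_def g1 by (auto intro: generate.incl)
  have step: "commutator d f \<in> D (Suc n)" if d: "d \<in> D n" and f: "f \<in> F" for d f n
  proof -
    interpret N: normal "D (Suc n)" G by (rule D_normal)
    show ?thesis
    proof (rule N.commutator_generate_mem[OF g_carrier g_carrier])
      show "d \<in> generate G (g n)" using d by (simp add: D_def)
      show "f \<in> generate G (g 1)" using f by (simp add: F_def D_def)
      fix s t assume s: "s \<in> g n" and t: "t \<in> g 1"
      obtain i where i: "i \<le> n" "s \<in> l A i" "s \<in> l B (n - i)" using s by (auto simp: g_def)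
      have tc: "t \<in> carrier G" using t g_carrier by blast
      \<comment> \<open>A commutator with an element of \<open>A\<close> raises the index in the
        series of \<open>A\<close>, and normality keeps it in the same term of the series of
        \<open>B\<close>; likewise with \<open>A\<close> and \<open>B\<close> exchanged.\<close>
      have "commutator s t \<in> g (Suc n)"
      proof (cases "t \<in> A")
        case True
        then have "commutator s t \<in> l A (Suc i) \<inter> l B (n - i)"
          using l_comm[OF A(1) i(2)] commutator_in_normal_left[OF l_normal[OF B(1)] i(3) tc] by blast
        then show ?thesis using i(1) by (auto simp: g_def intro!: bexI[of _ "Suc i"])
      next
        case False
        then have "t \<in> B" using t g1 by blast
        then have "commutator s t \<in> l A i \<inter> l B (Suc (n - i))"
          using l_comm[OF B(1) i(3)] commutator_in_normal_left[OF l_normal[OF A(1)] i(2) tc] by blast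
        then show ?thesis using i(1) by (auto simp: g_def Suc_diff_le intro!: bexI[of _ i])
      qed
      then show "commutator s t \<in> D (Suc n)" by (simp add: D_def generate.incl)
    qed
  qed
  have FG: "subgroup F G" using F by (rule normal_imp_subgroup)
  interpret GF: group "G\<lparr>carrier := F\<rparr>" by (rule subgroup_imp_group[OF FG])
  have lc: "lower_central (G\<lparr>carrier := F\<rparr>) (Suc n) \<subseteq> D (Suc n)" for n
  proof (induction n)
    case 0
    then show ?case by (simp add: F_def)
  next
    case (Suc n)
    have "commutator_subgroup G (D (Suc n)) F \<subseteq> D (Suc (Suc n))"
      unfolding commutator_subgroup_def
      using step by (intro generate_subgroup_incl normal_imp_subgroup D_normal) blast
    moreover have "lower_central (G\<lparr>carrier := F\<rparr>) (Suc (Suc n)) =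
        commutator_subgroup G (lower_central (G\<lparr>carrier := F\<rparr>) (Suc n)) F"
      by (rule lower_central_restrict_Suc[OF FG]) simp
    ultimately show ?case
      using commutator_subgroup_mono[OF Suc subset_refl, of F] by blast
  qed
  \<comment> \<open>Two indices with sum \<open>a + b + 1\<close> cannot both lie below the points
    \<open>a\<close> and \<open>b\<close> where the two series become trivial.\<close>
  have "g (Suc (a + b)) \<subseteq> {\<one>}"
  proof
    fix s assume "s \<in> g (Suc (a + b))"
    then obtain i where i: "s \<in> l A i" "s \<in> l B (Suc (a + b) - i)" by (auto simp: g_def)
    have "i \<ge> a \<or> Suc (a + b) - i \<ge> b" by linarith
    then show "s \<in> {\<one>}" using triv i by blast
  qed
  then have "D (Suc (a + b)) \<subseteq> {\<one>}"
    unfolding D_def using triv_subgroup by (rule generate_subgroup_incl)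
  then have "lower_central (G\<lparr>carrier := F\<rparr>) (Suc (a + b)) = {\<one>}"
    using lc[of "a + b"] subgroup.one_closed[OF GF.lower_central_subgroup] by fastforce
  then have "nilpotent_group (G\<lparr>carrier := F\<rparr>)"
    unfolding nilpotent_group_def using GF.group_axioms by (auto intro!: exI[of _ "Suc (a + b)"])
  with F show thesis using AB by (rule that)
qed

end

section \<open>The Fitting subgroup and finite quotients\<close>

text \<open>A maximal member of the finite family is the largest one, since by Fitting's theorem it
  lies together with any other member in a common member.\<close>

lemma (in group) ex_largest_normal_nilpotent:
  assumes fin: "finite (carrier G)"
  obtains F where "F \<lhd> G" "nilpotent_group (G\<lparr>carrier := F\<rparr>)"
    "\<And>N. N \<lhd> G \<Longrightarrow> nilpotent_group (G\<lparr>carrier := N\<rparr>) \<Longrightarrow> N \<subseteq> F"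
proof -
  let ?A = "{N. N \<lhd> G \<and> nilpotent_group (G\<lparr>carrier := N\<rparr>)}"
  have "?A \<subseteq> Pow (carrier G)" using normal_imp_subgroup subgroup.subset by blast
  then have "finite ?A" by (rule finite_subset) (simp add: fin)
  moreover have "{\<one>} \<in> ?A"
  proof -
    have "nilpotent_group (G\<lparr>carrier := {\<one>}\<rparr>)"
      unfolding nilpotent_group_def using subgroup_imp_group[OF triv_subgroup]
      by (auto intro!: exI[of _ "Suc 0"])
    then show ?thesis using one_is_normal by simp
  qed
  ultimately obtain F where F: "F \<in> ?A" and max: "\<And>N. N \<in> ?A \<Longrightarrow> F \<subseteq> N \<Longrightarrow> F = N"
    using finite_has_maximal[of ?A] by blast
  show thesis
  proof (rule that)
    show "F \<lhd> G" "nilpotent_group (G\<lparr>carrier := F\<rparr>)" using F by simp_all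
    fix N assume N: "N \<lhd> G" "nilpotent_group (G\<lparr>carrier := N\<rparr>)"
    obtain F' where "F' \<lhd> G" "nilpotent_group (G\<lparr>carrier := F'\<rparr>)" "F \<subseteq> F'" "N \<subseteq> F'"
      using fitting[OF _ _ N, of F] F by auto
    then show "N \<subseteq> F" using max[of F'] by simp
  qed
qed

lemma (in group_hom) hom_restrict:
  assumes "subgroup A G" "subgroup B H" "h ` A \<subseteq> B"
  shows "group_hom (G\<lparr>carrier := A\<rparr>) (H\<lparr>carrier := B\<rparr>) h"
  using assms G.subgroup_imp_group H.subgroup_imp_group subgroup.mem_carrier[OF assms(1)]
  by (auto simp: group_hom_def group_hom_axioms_def hom_def image_subset_iff)

lemma (in group_hom) nilpotent_img:
  assumes "subgroup A G" "nilpotent_group (G\<lparr>carrier := A\<rparr>)"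
  shows "nilpotent_group (H\<lparr>carrier := h ` A\<rparr>)"
proof -
  interpret r: group_hom "G\<lparr>carrier := A\<rparr>" "H\<lparr>carrier := h ` A\<rparr>" h
    using assms subgroup_img_is_subgroup by (intro hom_restrict) auto
  obtain m where m: "m \<ge> 1" "lower_central (G\<lparr>carrier := A\<rparr>) m = {\<one>}"
    using assms(2) by (auto simp: nilpotent_group_def)
  have "lower_central (H\<lparr>carrier := h ` A\<rparr>) m = {\<one>\<^bsub>H\<^esub>}"
    using r.lower_central_img[of m] m by simp
  then show ?thesis
    unfolding nilpotent_group_def using m r.H.group_axioms by auto
qed

lemma (in group) Fitt_subgroup: "subgroup (Fitt G) G"
  unfolding Fitt_def
  by (intro generate_is_subgroup) (use normal_imp_subgroup subgroup.subset in blast)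

text \<open>Under a surjection, normal nilpotent subgroups have normal nilpotent images, so all
  generators of the Fitting subgroup are sent into \<open>F\<close>.\<close>

lemma (in group_hom) Fitt_img_subset:
  assumes surj: "h ` carrier G = carrier H"
    and F: "F \<lhd> H" "\<And>N. N \<lhd> H \<Longrightarrow> nilpotent_group (H\<lparr>carrier := N\<rparr>) \<Longrightarrow> N \<subseteq> F"
  shows "h ` Fitt G \<subseteq> F"
proof -
  let ?U = "\<Union>{N. N \<lhd> G \<and> nilpotent_group (G\<lparr>carrier := N\<rparr>)}"
  have "?U \<subseteq> carrier G" using normal_imp_subgroup subgroup.subset by blast
  then have "h ` Fitt G = generate H (h ` ?U)"
    unfolding Fitt_def by (rule generate_img[symmetric])
  also have "\<dots> \<subseteq> F"
  proof (rule H.generate_subgroup_incl)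
    have "h ` N \<subseteq> F" if "N \<lhd> G" "nilpotent_group (G\<lparr>carrier := N\<rparr>)" for N
      using that normal.surj_hom_normal_subgroup[OF that(1) group_hom_axioms surj]
        nilpotent_img[OF normal_imp_subgroup] F(2) by blast
    then show "h ` ?U \<subseteq> F" by blast
  qed (rule normal_imp_subgroup[OF F(1)])
  finally show ?thesis .
qed

text \<open>The map restricts to a homomorphism from \<open>Fitt G\<close> to the largest normal
  nilpotent subgroup \<open>F\<close> of \<open>H\<close>, so \<open>h x\<close> lies in
  \<open>\<gamma>\<^sub>m(F)\<close>; the divisibility theorem applies in \<open>F\<close>, whose
  order divides that of \<open>H\<close>.\<close>

lemma (in group_hom) prime_power_le_order_of_lower_central_Fitt:
  assumes surj: "h ` carrier G = carrier H" and fin: "finite (carrier H)" and m: "2 \<le> m"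
    and x: "x \<in> lower_central (G\<lparr>carrier := Fitt G\<rparr>) m"
    and p: "Factorial_Ring.prime p" "p dvd H.ord (h x)"
  shows "p ^ (m + 1) \<le> order H"
proof -
  obtain F where F: "F \<lhd> H" "nilpotent_group (H\<lparr>carrier := F\<rparr>)"
    "\<And>N. N \<lhd> H \<Longrightarrow> nilpotent_group (H\<lparr>carrier := N\<rparr>) \<Longrightarrow> N \<subseteq> F"
    using H.ex_largest_normal_nilpotent[OF fin] by blast
  have FH: "subgroup F H" using F(1) by (rule normal_imp_subgroup)
  interpret r: group_hom "G\<lparr>carrier := Fitt G\<rparr>" "H\<lparr>carrier := F\<rparr>" h
    by (intro hom_restrict G.Fitt_subgroup FH Fitt_img_subset[OF surj F(1,3)])
  have hx: "h x \<in> lower_central (H\<lparr>carrier := F\<rparr>) m"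
    using r.lower_central_img_subset x by blast
  have ord: "r.H.ord (h x) = H.ord (h x)"
    by (simp add: group.ord_def[OF r.H.group_axioms] H.ord_def flip: H.nat_pow_consistent)
  have FF: "finite F" using subgroup.subset[OF FH] fin finite_subset by blast
  have "p ^ (m + 1) dvd order (H\<lparr>carrier := F\<rparr>)"
    using FF F(2) m hx p ord by (intro r.H.prime_power_dvd_order[of m "h x"]) simp_all
  also have "order (H\<lparr>carrier := F\<rparr>) dvd order H"
    using H.lagrange[OF FH, symmetric] by (simp add: order_def)
  finally show ?thesis
    using fin by (intro dvd_imp_le) (simp_all add: H.order_gt_0_iff_finite)
qed

section \<open>Word length and residual finiteness growth\<close>

context group
begin

lemma foldr_mult_append:
  assumes "set u \<subseteq> carrier G" "set v \<subseteq> carrier G"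
  shows "foldr (\<otimes>) (u @ v) \<one> = foldr (\<otimes>) u \<one> \<otimes> foldr (\<otimes>) v \<one>"
proof -
  have closed: "foldr (\<otimes>) w \<one> \<in> carrier G" if "set w \<subseteq> carrier G" for w
    using that by (induction w) auto
  show ?thesis
    using assms by (induction u) (auto simp: closed m_assoc)
qed

lemma generate_word:
  assumes S: "S \<subseteq> carrier G" and x: "x \<in> generate G S"
  obtains w where "set w \<subseteq> S \<union> m_inv G ` S" "foldr (\<otimes>) w \<one> = x"
proof -
  have carr: "S \<union> m_inv G ` S \<subseteq> carrier G" using S by auto
  have "\<exists>w. set w \<subseteq> S \<union> m_inv G ` S \<and> foldr (\<otimes>) w \<one> = x"
    using x
  proof (induction rule: generate.induct)
    case one
    show ?case by (rule exI[of _ "[]"]) simp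
  next
    case (incl h)
    then show ?case using S by (intro exI[of _ "[h]"]) auto
  next
    case (inv h)
    then show ?case using S by (intro exI[of _ "[inv h]"]) auto
  next
    case (eng a b)
    then obtain u v where "set u \<subseteq> S \<union> m_inv G ` S" "foldr (\<otimes>) u \<one> = a"
      "set v \<subseteq> S \<union> m_inv G ` S" "foldr (\<otimes>) v \<one> = b" by blast
    then show ?case
      using carr foldr_mult_append[of u v] by (intro exI[of _ "u @ v"]) auto
  qed
  then show thesis using that by blast
qed

lemma word_length_le:
  assumes "set w \<subseteq> S \<union> m_inv G ` S"
  shows "word_length G S (foldr (\<otimes>) w \<one>) \<le> length w"
  unfolding word_length_def using assms by (intro Least_le) blast

lemma word_length_attained:
  assumes "finite_generating_set G S" "x \<in> carrier G"
  obtains w where "length w = word_length G S x" "set w \<subseteq> S \<union> m_inv G ` S" "foldr (\<otimes>) w \<one> = x"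
proof -
  have "S \<subseteq> carrier G" "x \<in> generate G S"
    using assms by (simp_all add: finite_generating_set_def)
  then obtain v where v: "set v \<subseteq> S \<union> m_inv G ` S" "foldr (\<otimes>) v \<one> = x"
    by (rule generate_word)
  define P where "P n \<longleftrightarrow> (\<exists>w. length w = n \<and> set w \<subseteq> S \<union> m_inv G ` S \<and> foldr (\<otimes>) w \<one> = x)" for n
  have "P (length v)"
    unfolding P_def using v by (intro exI[of _ v] conjI refl)
  then have "P (word_length G S x)"
    unfolding word_length_def P_def[symmetric] by (rule LeastI)
  then show thesis
    unfolding P_def using that by blast
qed

text \<open>Each letter of a word over \<open>S\<close> is rewritten over \<open>T\<close>. This
  links distortion, measured with \<open>S\<close>, to residual finiteness growth, measured with
  \<open>T\<close>.\<close>

lemma word_length_lipschitz: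
  assumes S: "finite_generating_set G S" and T: "finite_generating_set G T"
  obtains K where "\<And>x. x \<in> carrier G \<Longrightarrow> word_length G T x \<le> K * word_length G S x"
proof -
  let ?S = "S \<union> m_inv G ` S" and ?T = "T \<union> m_inv G ` T"
  have SG: "?S \<subseteq> carrier G" and TG: "?T \<subseteq> carrier G" and fin: "finite ?S"
    using S T by (auto simp: finite_generating_set_def)
  \<comment> \<open>The sum is a convenient upper bound for the length of every rewritten
    letter.\<close>
  define K where "K = (\<Sum>s\<in>?S. word_length G T s)"
  have word: "\<exists>v. set v \<subseteq> ?T \<and> foldr (\<otimes>) v \<one> = foldr (\<otimes>) w \<one> \<and> length v \<le> K * length w"
    if "set w \<subseteq> ?S" for w
    using that
  proof (induction w)
    case Nil
    show ?case by (rule exI[of _ "[]"]) simp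
  next
    case (Cons s w)
    then obtain v where v: "set v \<subseteq> ?T" "foldr (\<otimes>) v \<one> = foldr (\<otimes>) w \<one>" "length v \<le> K * length w"
      by auto
    have s: "s \<in> ?S" using Cons.prems by simp
    then have "s \<in> carrier G" using SG by (rule subsetD[rotated])
    then obtain u where u: "length u = word_length G T s" "set u \<subseteq> ?T" "foldr (\<otimes>) u \<one> = s"
      using word_length_attained[OF T] by blast
    have "length u \<le> K"
      unfolding u(1) K_def using s fin by (intro member_le_sum) auto
    moreover have "foldr (\<otimes>) (u @ v) \<one> = foldr (\<otimes>) (s # w) \<one>"
      using foldr_mult_append[of u v] u(3) v(2) subset_trans[OF u(2) TG] subset_trans[OF v(1) TG]
      by simp
    moreover have "length (u @ v) \<le> K * length (s # w)"
      using \<open>length u \<le> K\<close> v(3) by simp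
    moreover have "set (u @ v) \<subseteq> ?T" using u(2) v(1) by simp
    ultimately show ?case by blast
  qed
  show thesis
  proof (rule that)
    fix x assume "x \<in> carrier G"
    then obtain w where w: "length w = word_length G S x" "set w \<subseteq> ?S" "foldr (\<otimes>) w \<one> = x"
      using word_length_attained[OF S] by blast
    obtain v where "set v \<subseteq> ?T" "foldr (\<otimes>) v \<one> = x" "length v \<le> K * length w"
      using word[OF w(2)] w(3) by auto
    then show "word_length G T x \<le> K * word_length G S x"
      using word_length_le[of v T] w(1) by simp
  qed
qed

section \<open>Lower bounds for residual finiteness growth from powers of a distorted
  element\<close>

text \<open>Reduces the growth bound to finite quotients: it is enough that every prime
  \<open>p\<close> dividing the order of the image of \<open>x\<close> satisfies
  \<open>p ^ d \<le> order H\<close>. The elements tested are the powers \<open>x [^] M\<close> with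
  the exponents \<open>M\<close> constructed above.\<close>

lemma power_growth_le_RF:
  fixes d :: nat
  assumes S: "finite_generating_set G S" and T: "finite_generating_set G T"
    and x: "strictly_exp_distorted G S x"
    and quot: "\<And>(H :: nat monoid) \<phi> p. \<lbrakk>group_hom G H \<phi>; \<phi> ` carrier G = carrier H; finite (carrier H);
      Factorial_Ring.prime p; p dvd group.ord H (\<phi> x)\<rbrakk> \<Longrightarrow> p ^ d \<le> order H"
  shows "(\<lambda>n. enat (n ^ d)) \<preceq> RF G T"
proof -
  have xG: "x \<in> carrier G" and ord: "ord x = 0"
    using x by (auto simp: strictly_exp_distorted_def)
  obtain C2 :: real where C2: "\<And>n. n > 0 \<Longrightarrow> 2 ^ word_length G S (x [^] (n :: nat)) \<le> C2 * real n"
    using x unfolding strictly_exp_distorted_def by blast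
  obtain c0 :: nat where c0: "C2 < 2 ^ c0" using real_arch_pow[of 2 C2] by auto
  obtain K where K: "\<And>x. x \<in> carrier G \<Longrightarrow> word_length G T x \<le> K * word_length G S x"
    using word_length_lipschitz[OF S T] by blast
  obtain C where C: "\<And>n. n \<ge> 1 \<Longrightarrow> \<exists>M>0. M \<le> 2 ^ (C * n) \<and>
      (\<forall>p j. Factorial_Ring.prime p \<longrightarrow> \<not> p ^ j dvd M \<longrightarrow> n ^ d \<le> p ^ j \<or> n \<le> p)"
    using exists_exp_bounded_multiple[of d] by blast
  \<comment> \<open>\<open>K * (c0 + C)\<close> bounds the length of the test element over
    \<open>T\<close> per unit of \<open>n\<close>; adding 1 makes \<open>E\<close> positive even if
    \<open>K = 0\<close>.\<close>
  define E where "E = K * (c0 + C) + 1"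
  have "enat (n ^ d) \<le> enat E * RF G T (E * n)" if n: "n \<ge> 1" for n
  proof -
    obtain M :: nat where M: "M > 0" "M \<le> 2 ^ (C * n)"
      and Mp: "\<And>p j. Factorial_Ring.prime p \<Longrightarrow> \<not> p ^ j dvd M \<Longrightarrow> n ^ d \<le> p ^ j \<or> n \<le> p"
      using C[OF n] by blast
    let ?y = "x [^] M"
    \<comment> \<open>Only the upper distortion estimate enters: the length is logarithmic in
      \<open>M\<close>, hence linear in \<open>n\<close>.\<close>
    have "(2 :: real) ^ word_length G S ?y \<le> 2 ^ (c0 + C * n)"
    proof -
      have "real M \<le> 2 ^ (C * n)" using M(2) by (metis of_nat_le_iff of_nat_numeral of_nat_power)
      then have "C2 * real M \<le> 2 ^ c0 * 2 ^ (C * n)"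
        using c0 by (intro mult_mono) auto
      then show ?thesis using C2[OF M(1)] by (simp add: power_add)
    qed
    then have "word_length G S ?y \<le> c0 + C * n" by simp
    also have "\<dots> \<le> (c0 + C) * n" using n by (simp add: algebra_simps)
    finally have "K * word_length G S ?y \<le> K * ((c0 + C) * n)" by (rule mult_le_mono2)
    then have "word_length G T ?y \<le> E * n"
      using K[of ?y] xG by (simp add: E_def algebra_simps)
    moreover have "?y \<noteq> \<one>" using pow_eq_id[OF xG, of M] ord M(1) by simp
    ultimately have "detect G ?y \<le> RF G T (E * n)"
      unfolding RF_def using xG by (intro Sup_upper) auto
    moreover have "enat (n ^ d) \<le> detect G ?y"
      unfolding detect_def
    proof (intro Inf_greatest, clarify)
      fix H :: "nat monoid" and \<phi>
      assume H: "group H" "finite (carrier H)" and \<phi>: "\<phi> \<in> epi G H" "\<phi> ?y \<noteq> \<one>\<^bsub>H\<^esub>"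
      interpret group_hom G H \<phi>
        using \<phi>(1) H(1) group_axioms by (simp add: group_hom_def group_hom_axioms_def epi_def)
      have surj: "\<phi> ` carrier G = carrier H" using \<phi>(1) by (simp add: epi_def)
      have pos: "order H > 0" using H by (simp add: H.order_gt_0_iff_finite)
      have "\<not> H.ord (\<phi> x) dvd M"
        using \<phi>(2) xG H.pow_eq_id[of "\<phi> x" M] hom_nat_pow[of x M] by simp
      moreover have dvd: "H.ord (\<phi> x) dvd order H" using H.ord_dvd_group_order xG by simp
      moreover have "H.ord (\<phi> x) > 0" using pos dvd by (rule dvd_pos_nat)
      ultimately obtain p j where p: "Factorial_Ring.prime p" "j > 0" "p ^ j dvd H.ord (\<phi> x)" "\<not> p ^ j dvd M"
        using prime_power_dvd_not_dvd[of "H.ord (\<phi> x)" M] M(1) by blast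
      \<comment> \<open>Either the prime power \<open>p ^ j\<close>, a divisor of the order of
        \<open>H\<close>, is already large, or \<open>p \<ge> n\<close> and the hypothesis on
        quotients applies.\<close>
      have "n ^ d \<le> order H"
        using Mp[OF p(1,4)]
      proof
        assume "n ^ d \<le> p ^ j"
        also have "p ^ j \<le> order H" using p(3) dvd pos by (meson dvd_imp_le dvd_trans)
        finally show ?thesis .
      next
        assume "n \<le> p"
        then have "n ^ d \<le> p ^ d" by (rule power_mono) simp
        also have "p ^ d \<le> order H"
          using quot[OF group_hom_axioms surj H(2) p(1)] p(2,3) by (meson dvd_power dvd_trans)
        finally show ?thesis .
      qed
      then show "enat (n ^ d) \<le> enat (order H)" by simp
    qed
    ultimately have "enat (n ^ d) \<le> RF G T (E * n)" by (rule order_trans[rotated])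
    also have "\<dots> = 1 * RF G T (E * n)" by simp
    also have "\<dots> \<le> enat E * RF G T (E * n)"
      by (rule mult_right_mono) (simp_all add: E_def one_enat_def)
    finally show ?thesis .
  qed
  then show ?thesis
    unfolding growth_le_def by (intro exI[of _ E]) (simp add: E_def)
qed

end

theorem corollary1p4:
  fixes G :: "('a, 'b) monoid_scheme" and S T :: "'a set" and x :: 'a
  assumes "polycyclic G"
    and "infinite (carrier G)"
    and "finite_generating_set G S"
    and "finite_generating_set G T"
    and "x \<in> Fitt G"
    and "x \<noteq> \<one>\<^bsub>G\<^esub>"
    and "strictly_exp_distorted G S x"
  shows "(\<lambda>n. enat n) \<preceq> RF G T \<and>
    (\<forall>m>1. x \<in> lower_central (G\<lparr>carrier := Fitt G\<rparr>) m \<longrightarrow> (\<lambda>n. enat (n ^ (m + 1))) \<preceq> RF G T)"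
proof (intro conjI allI impI)
  interpret group G using assms(1) by (simp add: polycyclic_def)
  have xG: "x \<in> carrier G" using assms(7) by (simp add: strictly_exp_distorted_def)
  \<comment> \<open>For exponent 1 Lagrange's theorem is enough: a prime dividing the order of an
    element divides the order of the group.\<close>
  have "(\<lambda>n. enat (n ^ 1)) \<preceq> RF G T"
  proof (rule power_growth_le_RF[OF assms(3,4,7)])
    fix H :: "nat monoid" and \<phi> p
    assume \<phi>: "group_hom G H \<phi>" and fin: "finite (carrier H)" and p: "p dvd group.ord H (\<phi> x)"
    interpret group_hom G H \<phi> by (rule \<phi>)
    have "H.ord (\<phi> x) dvd order H" using H.ord_dvd_group_order xG by simp
    with p have "p dvd order H" by (rule dvd_trans)
    then show "p ^ 1 \<le> order H"
      using fin by (intro dvd_imp_le) (simp_all add: H.order_gt_0_iff_finite)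
  qed
  then show "(\<lambda>n. enat n) \<preceq> RF G T" by simp
  fix m :: nat
  assume m: "m > 1" and x: "x \<in> lower_central (G\<lparr>carrier := Fitt G\<rparr>) m"
  show "(\<lambda>n. enat (n ^ (m + 1))) \<preceq> RF G T"
  proof (rule power_growth_le_RF[OF assms(3,4,7)])
    fix H :: "nat monoid" and \<phi> p
    assume "group_hom G H \<phi>" "\<phi> ` carrier G = carrier H" "finite (carrier H)"
      "Factorial_Ring.prime p" "p dvd group.ord H (\<phi> x)"
    then show "p ^ (m + 1) \<le> order H"
      using m x by (intro group_hom.prime_power_le_order_of_lower_central_Fitt[where h = \<phi> and x = x]) simp_all
  qed
qed

end
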